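(* There is a polynomial-time algorithm that, given a ternary string $s$, computes a shortest sequence of prefix reversals transforming $s$ into its sorted (non-decreasing) rearrangement.
   Context: A ternary string is a finite word over $\{0,1,2\}$. The prefix reversal (flip) $f^{(i)}$ applied to $s=s_1\cdots s_n$ ($1\le i\le n$) yields $s_i s_{i-1}\cdots s_1 s_{i+1}\cdots s_n$. The sorted rearrangement of $s$ is the string with the same symbol multiplicities as $s$ in which all symbols appear in non-decreasing order. *)

theory Defs
  imports Main
begin

definition ternary :: "nat list \<Rightarrow> bool" where
  "ternary s \<longleftrightarrow> set s \<subseteq> {0, 1, 2}"

definition flip :: "nat \<Rightarrow> 'a list \<Rightarrow> 'a list" where
  "flip i s = rev (take i s) @ drop i s"

definition apply_flips :: "nat list \<Rightarrow> 'a list \<Rightarrow> 'a list" where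
  "apply_flips fs s = foldl (\<lambda>t i. flip i t) s fs"

definition valid_flips :: "nat \<Rightarrow> nat list \<Rightarrow> bool" where
  "valid_flips n fs \<longleftrightarrow> (\<forall>i \<in> set fs. 1 \<le> i \<and> i \<le> n)"

definition sorting_flips :: "nat list \<Rightarrow> nat list \<Rightarrow> bool" where
  "sorting_flips s fs \<longleftrightarrow> valid_flips (length s) fs \<and> apply_flips fs s = sort s"

definition shortest_sorting_flips :: "nat list \<Rightarrow> nat list \<Rightarrow> bool" where
  "shortest_sorting_flips s fs \<longleftrightarrow>
     sorting_flips s fs \<and> (\<forall>gs. sorting_flips s gs \<longrightarrow> length fs \<le> length gs)"

text \<open>A machine is (number of states, number of tape symbols, transition function).
  Symbol 0 is the blank; state 0 is the start state, state 1 the halting state.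
  The transition maps (state, read symbol) to (new state, written symbol, head move).\<close>
type_synonym tm = "nat \<times> nat \<times> (nat \<Rightarrow> nat \<Rightarrow> nat \<times> nat \<times> int)"

definition valid_tm :: "tm \<Rightarrow> bool" where
  "valid_tm M = (case M of (nQ, nG, \<delta>) \<Rightarrow>
     2 \<le> nQ \<and> 4 \<le> nG \<and>
     (\<forall>q < nQ. \<forall>a < nG. case \<delta> q a of (q', a', d) \<Rightarrow>
         q' < nQ \<and> a' < nG \<and> d \<in> {-1, 0, 1}))"

text \<open>Configuration: (state, tape, head position).\<close>
type_synonym config = "nat \<times> (int \<Rightarrow> nat) \<times> int"

definition halt_state :: nat where "halt_state = 1"

definition tm_step :: "tm \<Rightarrow> config \<Rightarrow> config" where
  "tm_step M c = (case M of (nQ, nG, \<delta>) \<Rightarrow> case c of (q, tp, h) \<Rightarrow>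
     if q = halt_state then c
     else (case \<delta> q (tp h) of (q', a', d) \<Rightarrow> (q', tp(h := a'), h + d)))"

definition tm_run :: "tm \<Rightarrow> nat \<Rightarrow> config \<Rightarrow> config" where
  "tm_run M t c = (tm_step M ^^ t) c"

definition init_config :: "nat list \<Rightarrow> config" where
  "init_config s = (0, (\<lambda>i. if 0 \<le> i \<and> i < int (length s) then s ! nat i + 1 else 0), 0)"

text \<open>Output encoding of a flip sequence: each index i in unary (i copies of symbol 1)
  followed by the separator symbol 2. Indices are at most the input length, so this
  encoding is polynomial in the input size.\<close>
definition enc_flips :: "nat list \<Rightarrow> nat list" where
  "enc_flips fs = concat (map (\<lambda>i. replicate i 1 @ [2]) fs)"

definition tape_holds :: "(int \<Rightarrow> nat) \<Rightarrow> nat list \<Rightarrow> bool" where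
  "tape_holds tp w \<longleftrightarrow> (\<forall>j < length w. tp (int j) = w ! j) \<and> tp (int (length w)) = 0"

definition tm_outputs_within :: "tm \<Rightarrow> nat list \<Rightarrow> nat \<Rightarrow> nat list \<Rightarrow> bool" where
  "tm_outputs_within M s t fs \<longleftrightarrow>
     (case tm_run M t (init_config s) of (q, tp, h) \<Rightarrow>
        q = halt_state \<and> tape_holds tp (enc_flips fs))"

end

theory Submission
  imports Defs "HOL-Library.Multiset"
begin

text \<open>A final letter \<open>2\<close> may be appended to the string without changing the distance to the sorted
  string. A flip removes at most one block of equal letters, so a string with \<open>n\<close> blocks needs at least
  \<open>n - 3\<close> flips. The distance is \<open>n - 3 + e\<close> with an excess \<open>e \<le> 2\<close> that depends only on the reduced word, and \<open>e\<close> is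
  computed by a finite automaton reading the word from right to left. Reductions \<open>x p x v \<longmapsto> rev p x v\<close> never
  decrease the excess: this is structural for the words lacking an adjacency \<open>01\<close> or \<open>12\<close> and their relatives,
  and otherwise a finite computation on the automaton, since between two occurrences of the first letter
  the word alternates between two letters. The same computation finds a reduction that keeps the excess, so
  greedy descent is optimal. A machine sweeping over its tape finds an improving flip with the automaton,
  performs it by repeatedly moving a letter to the front, and repeats this until the string is sorted.\<close>

section \<open>The automaton for the excess\<close>

text \<open>Excess 0 means that every flip removes a block, down to \<open>012\<close>. Such a flip
  creates no new pair of neighbours, so 01 and 12 must be present from the start; a word lacking one
  of them pays an extra flip. In \<open>End12\<close> words the only 12 stands at the end and is
  torn apart once an earlier 2 merges with the last one; reductions keep \<open>End212\<close> words
  in their class or turn them into \<open>End12\<close>. The kind \<open>Rare\<close> has no such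
  closed description, which is why a bounded search takes over there. The table itself needs no
  derivation: with cost = number of blocks + excess, it is enough that no flip lowers the cost by
  more than one and that some flip lowers it by one unless the word is sorted. Flips that remove no
  block enter as well: they lower the excess by at most one, and they are needed for
  \<open>12012\<close> and for words whose first letter does not recur, where no reduction
  helps.\<close>

datatype ltr = L0 | L1 | L2

text \<open>A state \<open>(x, k, i)\<close> records the first letter \<open>x\<close> of the word read so far (from right
  to left, the sentinel \<open>L2\<close> first), its kind \<open>k\<close>, and a number \<open>i\<close>. For words without equal neighbours the kinds are:
  \<open>Tiny\<close> for \<open>2\<close> and \<open>0212\<close> (excess 2); \<open>NoBoth\<close>, \<open>No01\<close>, \<open>No12\<close> when both of the adjacencies
  \<open>01\<close> and \<open>12\<close>, only the first, or only the second are missing; \<open>End12\<close> for \<open>u12\<close> and \<open>End212\<close> for \<open>u212\<close> with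
  the conditions on \<open>u\<close> given in the definitions of \<open>End_12\<close> and \<open>End_212\<close> below; \<open>Rare\<close> for the
  remaining words of excess 1; \<open>Good012\<close> for the words \<open>u12\<close> in which \<open>u\<close> alternates between \<open>0\<close> and \<open>1\<close> and
  ends in \<open>0\<close>; \<open>Good\<close> for the remaining words of excess 0. The table is the minimal automaton for the
  kind; it was found by computing all distances up to length 16.\<close>

datatype kind = Good | Good012 | NoBoth | No01 | No12 | End12 | End212 | Rare | Tiny

datatype idx = I0 | I1 | I2 | I3 | I4 | I5 | I6 | I7 | I8 | I9 | I10 | I11

type_synonym st = "ltr \<times> kind \<times> idx"

primrec (nonexhaustive) t10_Good :: "idx \<Rightarrow> kind \<times> idx" where
  "t10_Good I0 = (Good, I1)" | "t10_Good I1 = (Good, I1)" | "t10_Good I2 = (Good, I1)" |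
  "t10_Good I3 = (Good, I1)" |
  "t10_Good I4 = (Rare, I7)" | "t10_Good I5 = (Good, I1)"

primrec (nonexhaustive) t10_Good012 :: "idx \<Rightarrow> kind \<times> idx" where
  "t10_Good012 I0 = (Good012, I0)" | "t10_Good012 I1 = (Good012, I1)" | "t10_Good012 I2 = (Good012, I1)"

primrec (nonexhaustive) t10_NoBoth :: "idx \<Rightarrow> kind \<times> idx" where
  "t10_NoBoth I0 = (No12, I0)" | "t10_NoBoth I1 = (No12, I2)" | "t10_NoBoth I2 = (No12, I3)"

primrec (nonexhaustive) t10_No01 :: "idx \<Rightarrow> kind \<times> idx" where
  "t10_No01 I0 = (Rare, I4)" | "t10_No01 I1 = (Rare, I2)" | "t10_No01 I2 = (Good, I3)" |
  "t10_No01 I3 = (Good, I1)" |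
  "t10_No01 I4 = (Rare, I7)" | "t10_No01 I5 = (Good, I0)"

primrec (nonexhaustive) t10_No12 :: "idx \<Rightarrow> kind \<times> idx" where
  "t10_No12 I0 = (No12, I1)" | "t10_No12 I1 = (No12, I1)" | "t10_No12 I2 = (No12, I1)"

primrec (nonexhaustive) t10_End12 :: "idx \<Rightarrow> kind \<times> idx" where
  "t10_End12 I0 = (End12, I0)" | "t10_End12 I1 = (End12, I1)" | "t10_End12 I2 = (End12, I1)" |
  "t10_End12 I3 = (End12, I1)" |
  "t10_End12 I4 = (End12, I1)"

primrec (nonexhaustive) t10_End212 :: "idx \<Rightarrow> kind \<times> idx" where
  "t10_End212 I0 = (End212, I1)" | "t10_End212 I1 = (End212, I1)"

primrec (nonexhaustive) t10_Rare :: "idx \<Rightarrow> kind \<times> idx" where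
  "t10_Rare I0 = (Rare, I2)" | "t10_Rare I1 = (Good, I2)" | "t10_Rare I2 = (Good, I1)" |
  "t10_Rare I3 = (Rare, I7)" |
  "t10_Rare I4 = (Rare, I9)" | "t10_Rare I5 = (Rare, I10)" | "t10_Rare I6 = (Good, I1)" |
  "t10_Rare I7 = (Good, I1)" |
  "t10_Rare I8 = (Rare, I7)" | "t10_Rare I9 = (Good, I1)" | "t10_Rare I10 = (Good, I1)"

primrec (nonexhaustive) t10_Tiny :: "idx \<Rightarrow> kind \<times> idx" where
  "t10_Tiny I0 = (End212, I0)"

primrec (nonexhaustive) t20_Good :: "idx \<Rightarrow> kind \<times> idx" where
  "t20_Good I0 = (Rare, I0)" | "t20_Good I1 = (Good, I2)" | "t20_Good I2 = (Rare, I4)" |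
  "t20_Good I3 = (Rare, I6)" |
  "t20_Good I4 = (Good, I3)" | "t20_Good I5 = (Good, I8)"

primrec (nonexhaustive) t20_Good012 :: "idx \<Rightarrow> kind \<times> idx" where
  "t20_Good012 I0 = (End12, I0)" | "t20_Good012 I1 = (End12, I1)" | "t20_Good012 I2 = (End12, I3)"

primrec (nonexhaustive) t20_NoBoth :: "idx \<Rightarrow> kind \<times> idx" where
  "t20_NoBoth I0 = (NoBoth, I0)" | "t20_NoBoth I1 = (NoBoth, I1)" | "t20_NoBoth I2 = (NoBoth, I1)"

primrec (nonexhaustive) t20_No01 :: "idx \<Rightarrow> kind \<times> idx" where
  "t20_No01 I0 = (No01, I4)" | "t20_No01 I1 = (No01, I5)" | "t20_No01 I2 = (No01, I6)" |
  "t20_No01 I3 = (No01, I4)" |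
  "t20_No01 I4 = (No01, I5)" | "t20_No01 I5 = (No01, I4)"

primrec (nonexhaustive) t20_No12 :: "idx \<Rightarrow> kind \<times> idx" where
  "t20_No12 I0 = (No12, I0)" | "t20_No12 I1 = (No12, I1)" | "t20_No12 I2 = (No12, I2)"

primrec (nonexhaustive) t20_End12 :: "idx \<Rightarrow> kind \<times> idx" where
  "t20_End12 I0 = (End12, I2)" | "t20_End12 I1 = (End12, I3)" | "t20_End12 I2 = (End12, I4)" |
  "t20_End12 I3 = (End12, I5)" |
  "t20_End12 I4 = (End12, I6)"

primrec (nonexhaustive) t20_End212 :: "idx \<Rightarrow> kind \<times> idx" where
  "t20_End212 I0 = (Rare, I5)" | "t20_End212 I1 = (Good, I2)"

primrec (nonexhaustive) t20_Rare :: "idx \<Rightarrow> kind \<times> idx" where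
  "t20_Rare I0 = (Good, I3)" | "t20_Rare I1 = (Good, I6)" | "t20_Rare I2 = (Good, I2)" |
  "t20_Rare I3 = (Good, I2)" |
  "t20_Rare I4 = (Rare, I9)" | "t20_Rare I5 = (Rare, I8)" | "t20_Rare I6 = (Good, I6)" |
  "t20_Rare I7 = (Rare, I7)" |
  "t20_Rare I8 = (Rare, I8)" | "t20_Rare I9 = (Rare, I6)" | "t20_Rare I10 = (Rare, I11)"

primrec (nonexhaustive) t20_Tiny :: "idx \<Rightarrow> kind \<times> idx" where
  "t20_Tiny I0 = (No01, I2)"

primrec (nonexhaustive) t01_Good :: "idx \<Rightarrow> kind \<times> idx" where
  "t01_Good I0 = (Good, I1)" | "t01_Good I1 = (Good, I1)" | "t01_Good I2 = (Good, I1)" |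
  "t01_Good I3 = (Good, I1)"

primrec (nonexhaustive) t01_Good012 :: "idx \<Rightarrow> kind \<times> idx" where
  "t01_Good012 I0 = (Good012, I1)" | "t01_Good012 I1 = (Good012, I2)"

primrec (nonexhaustive) t01_No01 :: "idx \<Rightarrow> kind \<times> idx" where
  "t01_No01 I0 = (Good012, I0)" | "t01_No01 I1 = (Good, I0)" | "t01_No01 I2 = (Rare, I1)" |
  "t01_No01 I3 = (Good, I5)" |
  "t01_No01 I4 = (Good, I1)" | "t01_No01 I5 = (Rare, I6)" | "t01_No01 I6 = (Rare, I2)" |
  "t01_No01 I7 = (Rare, I2)"

primrec (nonexhaustive) t01_No12 :: "idx \<Rightarrow> kind \<times> idx" where
  "t01_No12 I0 = (No12, I0)" | "t01_No12 I1 = (No12, I1)" | "t01_No12 I2 = (No12, I2)" |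
  "t01_No12 I3 = (No12, I1)"

primrec (nonexhaustive) t01_End12 :: "idx \<Rightarrow> kind \<times> idx" where
  "t01_End12 I0 = (End12, I2)" | "t01_End12 I1 = (End12, I1)"

primrec (nonexhaustive) t01_End212 :: "idx \<Rightarrow> kind \<times> idx" where
  "t01_End212 I0 = (End212, I0)" | "t01_End212 I1 = (End212, I1)"

primrec (nonexhaustive) t01_Rare :: "idx \<Rightarrow> kind \<times> idx" where
  "t01_Rare I0 = (Good, I2)" | "t01_Rare I1 = (Good, I3)" | "t01_Rare I2 = (Rare, I3)" |
  "t01_Rare I3 = (Good, I1)" |
  "t01_Rare I4 = (Rare, I7)" | "t01_Rare I5 = (Good, I3)" | "t01_Rare I6 = (Good, I2)" |
  "t01_Rare I7 = (Good, I1)" |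
  "t01_Rare I8 = (Good, I1)" | "t01_Rare I9 = (Rare, I9)" | "t01_Rare I10 = (Rare, I2)" |
  "t01_Rare I11 = (Good, I1)"

primrec (nonexhaustive) t21_Good :: "idx \<Rightarrow> kind \<times> idx" where
  "t21_Good I0 = (Good, I4)" | "t21_Good I1 = (Good, I2)" | "t21_Good I2 = (Good, I7)" |
  "t21_Good I3 = (Rare, I10)"

primrec (nonexhaustive) t21_Good012 :: "idx \<Rightarrow> kind \<times> idx" where
  "t21_Good012 I0 = (Good, I1)" | "t21_Good012 I1 = (Good, I2)"

primrec (nonexhaustive) t21_No01 :: "idx \<Rightarrow> kind \<times> idx" where
  "t21_No01 I0 = (No01, I0)" | "t21_No01 I1 = (No01, I1)" | "t21_No01 I2 = (No01, I3)" |
  "t21_No01 I3 = (No01, I4)" |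
  "t21_No01 I4 = (No01, I4)" | "t21_No01 I5 = (No01, I4)" | "t21_No01 I6 = (No01, I7)" |
  "t21_No01 I7 = (No01, I4)"

primrec (nonexhaustive) t21_No12 :: "idx \<Rightarrow> kind \<times> idx" where
  "t21_No12 I0 = (Good, I0)" | "t21_No12 I1 = (Good, I2)" | "t21_No12 I2 = (Good, I5)" |
  "t21_No12 I3 = (Good, I3)"

primrec (nonexhaustive) t21_End12 :: "idx \<Rightarrow> kind \<times> idx" where
  "t21_End12 I0 = (Good, I7)" | "t21_End12 I1 = (Good, I2)"

primrec (nonexhaustive) t21_End212 :: "idx \<Rightarrow> kind \<times> idx" where
  "t21_End212 I0 = (Rare, I2)" | "t21_End212 I1 = (Good, I2)"

primrec (nonexhaustive) t21_Rare :: "idx \<Rightarrow> kind \<times> idx" where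
  "t21_Rare I0 = (Rare, I1)" | "t21_Rare I1 = (Rare, I3)" | "t21_Rare I2 = (Good, I2)" |
  "t21_Rare I3 = (Rare, I7)" |
  "t21_Rare I4 = (Good, I7)" | "t21_Rare I5 = (Rare, I8)" | "t21_Rare I6 = (Rare, I3)" |
  "t21_Rare I7 = (Good, I2)" |
  "t21_Rare I8 = (Rare, I6)" | "t21_Rare I9 = (Good, I7)" | "t21_Rare I10 = (Good, I2)" |
  "t21_Rare I11 = (Rare, I11)"

primrec (nonexhaustive) t02_Good :: "idx \<Rightarrow> kind \<times> idx" where
  "t02_Good I0 = (Rare, I0)" | "t02_Good I1 = (Rare, I2)" | "t02_Good I2 = (Good, I1)" |
  "t02_Good I3 = (Good, I4)" |
  "t02_Good I4 = (Rare, I2)" | "t02_Good I5 = (Rare, I0)" | "t02_Good I6 = (Good, I1)" |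
  "t02_Good I7 = (Rare, I2)" |
  "t02_Good I8 = (Good, I5)"

primrec (nonexhaustive) t02_NoBoth :: "idx \<Rightarrow> kind \<times> idx" where
  "t02_NoBoth I0 = (NoBoth, I1)" | "t02_NoBoth I1 = (NoBoth, I2)"

primrec (nonexhaustive) t02_No01 :: "idx \<Rightarrow> kind \<times> idx" where
  "t02_No01 I0 = (Tiny, I0)" | "t02_No01 I1 = (No01, I0)" | "t02_No01 I2 = (No01, I1)" |
  "t02_No01 I3 = (No01, I2)" |
  "t02_No01 I4 = (No01, I3)" | "t02_No01 I5 = (No01, I4)" | "t02_No01 I6 = (No01, I3)" |
  "t02_No01 I7 = (No01, I5)"

primrec (nonexhaustive) t02_No12 :: "idx \<Rightarrow> kind \<times> idx" where
  "t02_No12 I0 = (No12, I1)" | "t02_No12 I1 = (No12, I1)" | "t02_No12 I2 = (No12, I1)"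

primrec (nonexhaustive) t02_End12 :: "idx \<Rightarrow> kind \<times> idx" where
  "t02_End12 I0 = (End12, I0)" | "t02_End12 I1 = (End12, I1)" | "t02_End12 I2 = (End12, I3)" |
  "t02_End12 I3 = (End12, I1)" |
  "t02_End12 I4 = (End12, I1)" | "t02_End12 I5 = (End12, I4)" | "t02_End12 I6 = (End12, I4)"

primrec (nonexhaustive) t02_Rare :: "idx \<Rightarrow> kind \<times> idx" where
  "t02_Rare I0 = (Good, I5)" | "t02_Rare I1 = (Rare, I4)" | "t02_Rare I2 = (Rare, I5)" |
  "t02_Rare I3 = (Rare, I3)" |
  "t02_Rare I4 = (Good, I1)" | "t02_Rare I5 = (Rare, I8)" | "t02_Rare I6 = (Good, I1)" |
  "t02_Rare I7 = (Good, I1)" |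
  "t02_Rare I8 = (Rare, I3)" | "t02_Rare I9 = (Rare, I2)" | "t02_Rare I10 = (Rare, I10)" |
  "t02_Rare I11 = (Rare, I2)"

primrec (nonexhaustive) t02_Tiny :: "idx \<Rightarrow> kind \<times> idx" where
  "t02_Tiny I0 = (NoBoth, I0)"

primrec (nonexhaustive) t12_Good :: "idx \<Rightarrow> kind \<times> idx" where
  "t12_Good I0 = (Good, I0)" | "t12_Good I1 = (Good, I2)" | "t12_Good I2 = (Good, I1)" |
  "t12_Good I3 = (Good, I1)" |
  "t12_Good I4 = (Good, I0)" | "t12_Good I5 = (Good, I1)" | "t12_Good I6 = (Rare, I7)" |
  "t12_Good I7 = (Good, I1)" |
  "t12_Good I8 = (Rare, I7)"

primrec (nonexhaustive) t12_NoBoth :: "idx \<Rightarrow> kind \<times> idx" where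
  "t12_NoBoth I0 = (No01, I1)" | "t12_NoBoth I1 = (No01, I3)"

primrec (nonexhaustive) t12_No01 :: "idx \<Rightarrow> kind \<times> idx" where
  "t12_No01 I0 = (No01, I2)" | "t12_No01 I1 = (No01, I4)" | "t12_No01 I2 = (No01, I5)" |
  "t12_No01 I3 = (No01, I6)" |
  "t12_No01 I4 = (No01, I4)" | "t12_No01 I5 = (No01, I4)" | "t12_No01 I6 = (No01, I7)" |
  "t12_No01 I7 = (No01, I6)"

primrec (nonexhaustive) t12_No12 :: "idx \<Rightarrow> kind \<times> idx" where
  "t12_No12 I0 = (Rare, I1)" | "t12_No12 I1 = (Good, I1)" | "t12_No12 I2 = (Rare, I8)"

primrec (nonexhaustive) t12_End12 :: "idx \<Rightarrow> kind \<times> idx" where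
  "t12_End12 I0 = (Rare, I0)" | "t12_End12 I1 = (Rare, I5)" | "t12_End12 I2 = (Rare, I6)" |
  "t12_End12 I3 = (Good, I1)" |
  "t12_End12 I4 = (Rare, I11)" | "t12_End12 I5 = (Rare, I3)" | "t12_End12 I6 = (Rare, I7)"

primrec (nonexhaustive) t12_Rare :: "idx \<Rightarrow> kind \<times> idx" where
  "t12_Rare I0 = (Rare, I3)" | "t12_Rare I1 = (Rare, I7)" | "t12_Rare I2 = (Good, I0)" |
  "t12_Rare I3 = (Rare, I7)" |
  "t12_Rare I4 = (Rare, I8)" | "t12_Rare I5 = (Rare, I7)" | "t12_Rare I6 = (Good, I1)" |
  "t12_Rare I7 = (Rare, I7)" |
  "t12_Rare I8 = (Good, I1)" | "t12_Rare I9 = (Rare, I7)" | "t12_Rare I10 = (Good, I0)" |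
  "t12_Rare I11 = (Good, I1)"

primrec (nonexhaustive) t12_Tiny :: "idx \<Rightarrow> kind \<times> idx" where
  "t12_Tiny I0 = (No01, I0)"

fun tr :: "ltr \<Rightarrow> st \<Rightarrow> st" where
  "tr L0 (L0, s) = (L0, s)" |
  "tr L0 (L1, Good, i) = (L0, t01_Good i)" |
  "tr L0 (L1, Good012, i) = (L0, t01_Good012 i)" |
  "tr L0 (L1, No01, i) = (L0, t01_No01 i)" |
  "tr L0 (L1, No12, i) = (L0, t01_No12 i)" |
  "tr L0 (L1, End12, i) = (L0, t01_End12 i)" |
  "tr L0 (L1, End212, i) = (L0, t01_End212 i)" |
  "tr L0 (L1, Rare, i) = (L0, t01_Rare i)" |
  "tr L0 (L2, Good, i) = (L0, t02_Good i)" |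
  "tr L0 (L2, NoBoth, i) = (L0, t02_NoBoth i)" |
  "tr L0 (L2, No01, i) = (L0, t02_No01 i)" |
  "tr L0 (L2, No12, i) = (L0, t02_No12 i)" |
  "tr L0 (L2, End12, i) = (L0, t02_End12 i)" |
  "tr L0 (L2, Rare, i) = (L0, t02_Rare i)" |
  "tr L0 (L2, Tiny, i) = (L0, t02_Tiny i)" |
  "tr L1 (L0, Good, i) = (L1, t10_Good i)" |
  "tr L1 (L0, Good012, i) = (L1, t10_Good012 i)" |
  "tr L1 (L0, NoBoth, i) = (L1, t10_NoBoth i)" |
  "tr L1 (L0, No01, i) = (L1, t10_No01 i)" |
  "tr L1 (L0, No12, i) = (L1, t10_No12 i)" |
  "tr L1 (L0, End12, i) = (L1, t10_End12 i)" |
  "tr L1 (L0, End212, i) = (L1, t10_End212 i)" |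
  "tr L1 (L0, Rare, i) = (L1, t10_Rare i)" |
  "tr L1 (L0, Tiny, i) = (L1, t10_Tiny i)" |
  "tr L1 (L1, s) = (L1, s)" |
  "tr L1 (L2, Good, i) = (L1, t12_Good i)" |
  "tr L1 (L2, NoBoth, i) = (L1, t12_NoBoth i)" |
  "tr L1 (L2, No01, i) = (L1, t12_No01 i)" |
  "tr L1 (L2, No12, i) = (L1, t12_No12 i)" |
  "tr L1 (L2, End12, i) = (L1, t12_End12 i)" |
  "tr L1 (L2, Rare, i) = (L1, t12_Rare i)" |
  "tr L1 (L2, Tiny, i) = (L1, t12_Tiny i)" |
  "tr L2 (L0, Good, i) = (L2, t20_Good i)" |
  "tr L2 (L0, Good012, i) = (L2, t20_Good012 i)" |
  "tr L2 (L0, NoBoth, i) = (L2, t20_NoBoth i)" |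
  "tr L2 (L0, No01, i) = (L2, t20_No01 i)" |
  "tr L2 (L0, No12, i) = (L2, t20_No12 i)" |
  "tr L2 (L0, End12, i) = (L2, t20_End12 i)" |
  "tr L2 (L0, End212, i) = (L2, t20_End212 i)" |
  "tr L2 (L0, Rare, i) = (L2, t20_Rare i)" |
  "tr L2 (L0, Tiny, i) = (L2, t20_Tiny i)" |
  "tr L2 (L1, Good, i) = (L2, t21_Good i)" |
  "tr L2 (L1, Good012, i) = (L2, t21_Good012 i)" |
  "tr L2 (L1, No01, i) = (L2, t21_No01 i)" |
  "tr L2 (L1, No12, i) = (L2, t21_No12 i)" |
  "tr L2 (L1, End12, i) = (L2, t21_End12 i)" |
  "tr L2 (L1, End212, i) = (L2, t21_End212 i)" |
  "tr L2 (L1, Rare, i) = (L2, t21_Rare i)" |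
  "tr L2 (L2, s) = (L2, s)" |
  "tr c (_, s) = (c, s)"

fun sts :: "ltr \<Rightarrow> st list" where
  "sts L0 = map (Pair L0) (map (Pair Good) [I0, I1, I2, I3, I4, I5] @ map (Pair Good012) [I0, I1, I2] @
      map (Pair NoBoth) [I0, I1, I2] @ map (Pair No01) [I0, I1, I2, I3, I4, I5] @
      map (Pair No12) [I0, I1, I2] @ map (Pair End12) [I0, I1, I2, I3, I4] @ map (Pair End212) [I0, I1] @
      map (Pair Rare) [I0, I1, I2, I3, I4, I5, I6, I7, I8, I9, I10] @ map (Pair Tiny) [I0])" |
  "sts L1 = map (Pair L1) (map (Pair Good) [I0, I1, I2, I3] @ map (Pair Good012) [I0, I1] @
      map (Pair No01) [I0, I1, I2, I3, I4, I5, I6, I7] @ map (Pair No12) [I0, I1, I2, I3] @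
      map (Pair End12) [I0, I1] @ map (Pair End212) [I0, I1] @
      map (Pair Rare) [I0, I1, I2, I3, I4, I5, I6, I7, I8, I9, I10, I11])" |
  "sts L2 = map (Pair L2) (map (Pair Good) [I0, I1, I2, I3, I4, I5, I6, I7, I8] @
      map (Pair NoBoth) [I0, I1] @ map (Pair No01) [I0, I1, I2, I3, I4, I5, I6, I7] @
      map (Pair No12) [I0, I1, I2] @ map (Pair End12) [I0, I1, I2, I3, I4, I5, I6] @
      map (Pair Rare) [I0, I1, I2, I3, I4, I5, I6, I7, I8, I9, I10, I11] @ map (Pair Tiny) [I0])"

abbreviation act :: "ltr list \<Rightarrow> st \<Rightarrow> st" where "act \<equiv> foldr tr"

fun kind_of :: "st \<Rightarrow> kind" where "kind_of (x, k, i) = k"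

fun excess_kind :: "kind \<Rightarrow> nat" where
  "excess_kind Good = 0"
| "excess_kind Good012 = 0"
| "excess_kind Tiny = 2"
| "excess_kind _ = 1"

abbreviation excess :: "st \<Rightarrow> nat" where "excess q \<equiv> excess_kind (kind_of q)"

text \<open>Each of these states is reached by a single word without equal neighbours, its index (fact \<open>unique_tr\<close>).\<close>

abbreviation q_2 :: st where "q_2 \<equiv> (L2, Tiny, I0)"
abbreviation q_12 :: st where "q_12 \<equiv> (L1, No01, I0)"
abbreviation q_212 :: st where "q_212 \<equiv> (L2, No01, I0)"
abbreviation q_0212 :: st where "q_0212 \<equiv> (L0, Tiny, I0)"
abbreviation q_012 :: st where "q_012 \<equiv> (L0, Good012, I0)"
abbreviation q_2012 :: st where "q_2012 \<equiv> (L2, End12, I0)"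
abbreviation q_12012 :: st where "q_12012 \<equiv> (L1, Rare, I0)"

section \<open>Finite checks over alternating patterns\<close>

fun alt :: "nat \<Rightarrow> 'a \<Rightarrow> 'a \<Rightarrow> 'a list" where
  "alt 0 a b = []"
| "alt (Suc n) a b = a # alt n b a"

fun others :: "ltr \<Rightarrow> (ltr \<times> ltr) list" where
  "others L0 = [(L1, L2), (L2, L1)]"
| "others L1 = [(L0, L2), (L2, L0)]"
| "others L2 = [(L0, L1), (L1, L0)]"

text \<open>Every word over two letters without equal neighbours acts on the states like an alternating
  word of length less than 10, because \<open>(ab)\<^sup>5\<close> acts like \<open>(ab)\<^sup>4\<close> (fact \<open>pump10\<close>).\<close>

definition pats :: "ltr \<Rightarrow> ltr list list" where
  "pats x = concat (map (\<lambda>(a, b). map (\<lambda>n. alt n a b) [1..<10]) (others x))"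

text \<open>All ways to explain \<open>q\<close> by a gap \<open>p\<close> without \<open>x\<close>
  and a state of the rest. Whether such a rest exists as a word is ignored, which can only make the
  checks stronger.\<close>

definition pre :: "ltr \<Rightarrow> st \<Rightarrow> (ltr list \<times> st) list" where
  "pre x q = concat (map (\<lambda>p. map (Pair p) (filter (\<lambda>q'. tr x (act p q') = q) (sts x))) (pats x))"

text \<open>In the word \<open>x u x v\<close> with \<open>q\<close> the state of \<open>x v\<close>, the checks look at the reduction \<open>rev u x v\<close> and then
  at all possible positions of the next \<open>x\<close> in \<open>v\<close>, up to depth \<open>k\<close>.\<close>

fun chk_rare :: "nat \<Rightarrow> ltr \<Rightarrow> ltr list \<Rightarrow> st \<Rightarrow> bool" where
  "chk_rare k x u q \<longleftrightarrow>
     (if kind_of (tr x (act u q)) \<noteq> Rare then True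
      else if excess (act (rev u) q) = 0 then False
      else list_all (\<lambda>(p, q'). case k of 0 \<Rightarrow> False
        | Suc k' \<Rightarrow> chk_rare k' x (u @ x # p) q') (pre x q))"

text \<open>The states of \<open>x v\<close> where \<open>x\<close> does not recur in
  \<open>v\<close>. For \<open>L2\<close> nothing is left, since every word ends in the sentinel;
  otherwise \<open>v\<close> alternates between the other two letters.\<close>

fun terms :: "ltr \<Rightarrow> st list" where
  "terms L2 = [q_2]"
| "terms x = map (\<lambda>p. tr x (act p q_2)) (pats x)"

text \<open>In \<open>2\<close>, \<open>0212\<close> and \<open>012\<close> the first letter does
  not recur, so there is no reduction; the only reduction of \<open>12012\<close> leads to
  \<open>0212\<close> and raises the excess from 1 to 2.\<close>

definition reducible :: "st \<Rightarrow> bool" where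
  "reducible q \<longleftrightarrow> kind_of q \<noteq> Tiny \<and> q \<noteq> q_012 \<and> q \<noteq> q_12012"

fun chk_good :: "nat \<Rightarrow> ltr \<Rightarrow> ltr list \<Rightarrow> st \<Rightarrow> bool" where
  "chk_good k x u q \<longleftrightarrow>
     (let s = tr x (act u q) in
      if \<not> reducible s then True
      else if excess (act (rev u) q) = excess s then True
      else if q \<in> set (terms x) then False
      else case k of 0 \<Rightarrow> False
        | Suc k' \<Rightarrow> list_all (\<lambda>(p, q'). chk_good k' x (u @ x # p) q') (pre x q))"

text \<open>The depths 5 and 3 below are enough since words of kind \<open>Rare\<close> repeat their first letter only a
  few times, and since one of the first few repetitions always admits a reduction that keeps the excess.\<close>

declare chk_rare.simps [simp del] chk_good.simps [simp del]

lemma chk_rare_all: "list_all (\<lambda>q. list_all (\<lambda>p. chk_rare 5 x p q) (pats x)) (sts x)"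
proof (cases x)
  case L0 show ?thesis unfolding L0 by code_simp
next
  case L1 show ?thesis unfolding L1 by code_simp
next
  case L2 show ?thesis unfolding L2 by code_simp
qed

lemma chk_good_all: "list_all (\<lambda>q. list_all (\<lambda>p. chk_good 3 x p q) (pats x)) (sts x)"
proof (cases x)
  case L0 show ?thesis unfolding L0 by code_simp
next
  case L1 show ?thesis unfolding L1 by code_simp
next
  case L2 show ?thesis unfolding L2 by code_simp
qed

definition all_trans :: "(ltr \<Rightarrow> st \<Rightarrow> bool) \<Rightarrow> bool" where
  "all_trans P \<longleftrightarrow> list_all (\<lambda>x. list_all (\<lambda>q. list_all (\<lambda>c. c = x \<or> P c q) [L0, L1, L2]) (sts x)) [L0, L1, L2]"

text \<open>The tables are partial functions; closure of \<open>sts\<close> shows that no run leaves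
  their domain.\<close>

lemma tr_closed: "all_trans (\<lambda>c q. tr c q \<in> set (sts c))"
  by code_simp

section \<open>Transition rules for the structural kinds\<close>

definition joins :: "ltr \<Rightarrow> ltr \<Rightarrow> ltr \<Rightarrow> ltr \<Rightarrow> bool" where
  "joins a b c d \<longleftrightarrow> c = a \<and> d = b \<or> c = b \<and> d = a"

definition no01 :: "st \<Rightarrow> bool" where "no01 q \<longleftrightarrow> kind_of q = NoBoth \<or> kind_of q = No01 \<or> kind_of q = Tiny"
definition no12 :: "st \<Rightarrow> bool" where "no12 q \<longleftrightarrow> kind_of q = NoBoth \<or> kind_of q = No12 \<or> q = q_2"
definition pre12 :: "st \<Rightarrow> bool" where "pre12 q \<longleftrightarrow> kind_of q = Good012 \<or> q = q_12"
definition end12 :: "st \<Rightarrow> bool" where "end12 q \<longleftrightarrow> kind_of q = End12"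
definition end212 :: "st \<Rightarrow> bool" where "end212 q \<longleftrightarrow> kind_of q = End212 \<or> q = q_0212"

text \<open>Each of the rules up to \<open>end212_tr\<close> is the recursion that a property of
  words obeys when a letter is put in front; table and property then agree by induction on the
  word.\<close>

lemma no01_tr: "all_trans (\<lambda>c q. no01 (tr c q) \<longleftrightarrow> no01 q \<and> \<not> joins L0 L1 c (fst q))"
  by code_simp
lemma no12_tr: "all_trans (\<lambda>c q. no12 (tr c q) \<longleftrightarrow> no12 q \<and> \<not> joins L1 L2 c (fst q))"
  by code_simp
lemma pre12_tr: "all_trans (\<lambda>c q. pre12 (tr c q) \<longleftrightarrow> (if q = q_2 then c = L1 else pre12 q \<and> c \<noteq> L2))"
  by code_simp
lemma end12_tr: "all_trans (\<lambda>c q. end12 (tr c q) \<longleftrightarrow>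
    end12 q \<and> \<not> joins L1 L2 c (fst q) \<or> pre12 q \<and> c = L2 \<and> fst q = L0)"
  by code_simp
lemma end212_tr: "all_trans (\<lambda>c q. end212 (tr c q) \<longleftrightarrow> (if q = q_212 then c = L0 else end212 q \<and> c \<noteq> L2))"
  by code_simp

lemma pump10: "list_all (\<lambda>x. list_all (\<lambda>q. list_all (\<lambda>(a, b). a = b \<or> act (alt 10 a b) q = act (alt 8 a b) q)
   (List.product [L0, L1, L2] [L0, L1, L2])) (sts x)) [L0, L1, L2]"
  by code_simp

lemma unique_tr: "all_trans (\<lambda>c q. tr c q \<noteq> q_2 \<and>
    (tr c q = q_12 \<longrightarrow> c = L1 \<and> q = q_2) \<and>
    (tr c q = q_212 \<longrightarrow> c = L2 \<and> q = q_12) \<and> (tr c q = q_0212 \<longrightarrow> c = L0 \<and> q = q_212) \<and>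
    (tr c q = q_012 \<longrightarrow> c = L0 \<and> q = q_12) \<and> (tr c q = q_2012 \<longrightarrow> c = L2 \<and> q = q_012) \<and>
    (tr c q = q_12012 \<longrightarrow> c = L1 \<and> q = q_2012))"
  by code_simp

text \<open>For words in which the first letter \<open>x\<close> does not recur: reversing the first
  two or the first three letters keeps the number of blocks and must lower the excess.\<close>

definition chk_single :: "ltr \<Rightarrow> ltr \<Rightarrow> ltr \<Rightarrow> nat \<Rightarrow> bool" where
  "chk_single x a b n \<longleftrightarrow> 2 \<le> n \<and>
     (let e = excess (tr x (act (alt n a b) q_2)) in
      Suc (excess (tr a (tr x (act (alt (n - 1) b a) q_2)))) = e \<or>
      3 \<le> n \<and> Suc (excess (tr b (tr a (tr x (act (alt (n - 2) a b) q_2))))) = e)"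

text \<open>Exempt are words not ending in the sentinel and the sorted words \<open>x2\<close> and
  \<open>012\<close>. Longer alternations are pumped down below 14 in
  \<open>chk_single_alt\<close>.\<close>

lemma chk_single_all:
  "list_all (\<lambda>x. list_all (\<lambda>(a, b). list_all (\<lambda>n. last (alt n a b) \<noteq> L2 \<or> n = 1 \<or> (x, n) = (L0, 2) \<and> a = L1 \<or>
     chk_single x a b n) [1..<14]) (others x)) [L0, L1]"
  by code_simp

section \<open>Runs of the automaton\<close>

lemma fst_tr [simp]: "fst (tr c q) = c"
  by (cases "(c, q)" rule: tr.cases) auto

lemma tr_same: "fst q = c \<Longrightarrow> tr c q = q"
  by (cases q; cases c) auto

lemma tr_tr [simp]: "tr c (tr c q) = tr c q"
  by (rule tr_same) simp

lemma fst_sts: "q \<in> set (sts x) \<Longrightarrow> fst q = x"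
  by (cases x) (simp_all only: sts.simps set_map, auto)

definition valid :: "st \<Rightarrow> bool" where "valid q \<longleftrightarrow> q \<in> set (sts (fst q))"

lemma validI: "q \<in> set (sts x) \<Longrightarrow> valid q"
  using fst_sts[of q x] by (simp add: valid_def)

lemma all_transD:
  assumes "all_trans P" "valid q" "c \<noteq> fst q"
  shows "P c q"
proof -
  have "c \<in> set [L0, L1, L2]" "fst q \<in> set [L0, L1, L2]" by (cases c; simp; fail) (cases "fst q"; simp)
  then show ?thesis using assms unfolding all_trans_def valid_def list_all_iff by blast
qed

lemma valid_tr: "valid q \<Longrightarrow> valid (tr c q)"
  using all_transD[OF tr_closed, of q c] tr_same[of q c] validI by (cases "c = fst q") auto

lemma valid_act: "valid q \<Longrightarrow> valid (act p q)"
  by (induction p) (auto intro: valid_tr)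

lemma valid_q_2 [simp]: "valid q_2"
  by (simp add: valid_def)

definition run :: "ltr list \<Rightarrow> st" where "run w = act w q_2"

lemma run_Cons [simp]: "run (c # w) = tr c (run w)"
  and run_Nil [simp]: "run [] = q_2"
  by (simp_all add: run_def)

lemma run_append: "run (u @ v) = act u (run v)"
  by (simp add: run_def)

lemma valid_run [simp]: "valid (run w)"
  by (simp add: run_def valid_act)

lemma act_remdups_adj: "act (remdups_adj w) q = act w q"
  by (induction w rule: remdups_adj.induct) auto

lemma fst_run: "w \<noteq> [] \<Longrightarrow> fst (run w) = hd w"
  by (cases w) auto

text \<open>Words of the form \<open>w @ [L2]\<close> without repeated neighbours: the final \<open>L2\<close> is the sentinel.\<close>
definition word :: "ltr list \<Rightarrow> bool" where
  "word r \<longleftrightarrow> distinct_adj r \<and> r \<noteq> [] \<and> last r = L2"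

lemma word_Cons: "r \<noteq> [] \<Longrightarrow> word (c # r) \<longleftrightarrow> c \<noteq> hd r \<and> word r"
  by (auto simp: word_def distinct_adj_Cons)

lemma word_single: "word [c] \<longleftrightarrow> c = L2"
  by (auto simp: word_def)

lemma word_append: "v \<noteq> [] \<Longrightarrow> word (u @ v) \<Longrightarrow> word v"
  by (auto simp: word_def distinct_adj_append_iff)

lemma word_trans: "all_trans P \<Longrightarrow> word (c # r) \<Longrightarrow> r \<noteq> [] \<Longrightarrow> P c (run r)"
  by (rule all_transD) (auto simp: word_Cons fst_run)

lemma word_cases [consumes 1, case_names single Cons]:
  assumes "word r"
  obtains "r = [L2]" | c r' where "r = c # r'" "r' \<noteq> []" "word r'" "c \<noteq> hd r'"
proof (cases r)
  case (Cons c r')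
  then show ?thesis using assms that by (cases "r' = []") (simp_all add: word_single word_Cons)
qed (use assms in \<open>simp add: word_def\<close>)

lemma run_q_2:
  assumes "word r" "run r = q_2"
  shows "r = [L2]"
  using assms(1)
proof (cases rule: word_cases)
  case (Cons c r')
  then have "tr c (run r') \<noteq> q_2" using word_trans[OF unique_tr, of c r'] assms(1) by blast
  then show ?thesis using assms(2) Cons(1) by (simp only: run_Cons)
qed

lemma run_q_12:
  assumes "word r" "run r = q_12"
  shows "r = [L1, L2]"
  using assms(1)
proof (cases rule: word_cases)
  case single
  then show ?thesis using assms(2) by simp
next
  case (Cons c r')
  have "tr c (run r') = q_12" using assms(2) Cons(1) by (simp only: run_Cons)
  then have "c = L1 \<and> run r' = q_2"
    using word_trans[OF unique_tr, of c r'] assms(1) Cons(1,2) by blast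
  then show ?thesis using run_q_2[OF Cons(3)] Cons(1) by blast
qed

lemma run_q_212:
  assumes "word r" "run r = q_212"
  shows "r = [L2, L1, L2]"
  using assms(1)
proof (cases rule: word_cases)
  case single
  then show ?thesis using assms(2) by simp
next
  case (Cons c r')
  have "tr c (run r') = q_212" using assms(2) Cons(1) by (simp only: run_Cons)
  then have "c = L2 \<and> run r' = q_12"
    using word_trans[OF unique_tr, of c r'] assms(1) Cons(1,2) by blast
  then show ?thesis using run_q_12[OF Cons(3)] Cons(1) by blast
qed

lemma run_q_0212:
  assumes "word r" "run r = q_0212"
  shows "r = [L0, L2, L1, L2]"
  using assms(1)
proof (cases rule: word_cases)
  case single
  then show ?thesis using assms(2) by simp
next
  case (Cons c r')
  have "tr c (run r') = q_0212" using assms(2) Cons(1) by (simp only: run_Cons)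
  then have "c = L0 \<and> run r' = q_212"
    using word_trans[OF unique_tr, of c r'] assms(1) Cons(1,2) by blast
  then show ?thesis using run_q_212[OF Cons(3)] Cons(1) by blast
qed

lemma run_q_012:
  assumes "word r" "run r = q_012"
  shows "r = [L0, L1, L2]"
  using assms(1)
proof (cases rule: word_cases)
  case single
  then show ?thesis using assms(2) by simp
next
  case (Cons c r')
  have "tr c (run r') = q_012" using assms(2) Cons(1) by (simp only: run_Cons)
  then have "c = L0 \<and> run r' = q_12"
    using word_trans[OF unique_tr, of c r'] assms(1) Cons(1,2) by blast
  then show ?thesis using run_q_12[OF Cons(3)] Cons(1) by blast
qed

lemma run_q_2012:
  assumes "word r" "run r = q_2012"
  shows "r = [L2, L0, L1, L2]"
  using assms(1)
proof (cases rule: word_cases)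
  case single
  then show ?thesis using assms(2) by simp
next
  case (Cons c r')
  have "tr c (run r') = q_2012" using assms(2) Cons(1) by (simp only: run_Cons)
  then have "c = L2 \<and> run r' = q_012"
    using word_trans[OF unique_tr, of c r'] assms(1) Cons(1,2) by blast
  then show ?thesis using run_q_012[OF Cons(3)] Cons(1) by blast
qed

lemma run_q_12012:
  assumes "word r" "run r = q_12012"
  shows "r = [L1, L2, L0, L1, L2]"
  using assms(1)
proof (cases rule: word_cases)
  case single
  then show ?thesis using assms(2) by simp
next
  case (Cons c r')
  have "tr c (run r') = q_12012" using assms(2) Cons(1) by (simp only: run_Cons)
  then have "c = L1 \<and> run r' = q_2012"
    using word_trans[OF unique_tr, of c r'] assms(1) Cons(1,2) by blast
  then show ?thesis using run_q_2012[OF Cons(3)] Cons(1) by blast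
qed

lemma Tiny_sts: "list_all (\<lambda>q. kind_of q = Tiny \<longrightarrow> q = q_2 \<or> q = q_0212) (sts x)"
  by (cases x; simp only:; code_simp)

lemma Tiny_word:
  assumes "word r" "kind_of (run r) = Tiny"
  shows "r = [L2] \<or> r = [L0, L2, L1, L2]"
proof -
  have "run r \<in> set (sts (fst (run r)))" using valid_run[of r] by (simp add: valid_def)
  then have "run r = q_2 \<or> run r = q_0212"
    using assms(2) Tiny_sts[of "fst (run r)"] unfolding list_all_iff by blast
  then show ?thesis using run_q_2[OF assms(1)] run_q_0212[OF assms(1)] by blast
qed

section \<open>Pumping words over two letters\<close>

text \<open>The reversals are compared too, because a reduction makes the automaton read the same
  segment in both directions.\<close>

definition eqv :: "ltr list \<Rightarrow> ltr list \<Rightarrow> bool" where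
  "eqv p p' \<longleftrightarrow> (\<forall>q. valid q \<longrightarrow> act p q = act p' q \<and> act (rev p) q = act (rev p') q)"

lemma eqv_refl [simp]: "eqv p p"
  by (simp add: eqv_def)

lemma eqv_trans: "eqv p p' \<Longrightarrow> eqv p' p'' \<Longrightarrow> eqv p p''"
  by (simp add: eqv_def)

lemma eqv_append: "eqv p p' \<Longrightarrow> eqv u u' \<Longrightarrow> eqv (u @ x # p) (u' @ x # p')"
  unfolding eqv_def by (simp add: valid_act valid_tr del: split_paired_All)

lemma eqv_act: "eqv p p' \<Longrightarrow> act p (run v) = act p' (run v)"
  and eqv_act_rev: "eqv p p' \<Longrightarrow> act (rev p) (run v) = act (rev p') (run v)"
  using valid_run[of v] unfolding eqv_def by blast+

lemma all_letters: "list_all P [L0, L1, L2] \<Longrightarrow> P c"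
  by (cases c) simp_all

lemma list_allD: "list_all P xs \<Longrightarrow> x \<in> set xs \<Longrightarrow> P x"
  by (simp add: list_all_iff)

lemma pump10D:
  assumes "valid q"
  shows "act (alt 10 a b) q = act (alt 8 a b) q"
proof (cases "a = b")
  case True
  then show ?thesis by (simp add: eval_nat_numeral)
next
  case False
  have "(a, b) \<in> set (List.product [L0, L1, L2] [L0, L1, L2])"
    by (cases a; cases b) simp_all
  from list_allD[OF list_allD[OF all_letters[OF pump10] assms[unfolded valid_def]] this]
  show ?thesis using False by simp
qed

text \<open>Reversing an alternating word of even length only swaps its two letters, so
  \<open>pump10\<close> covers both directions.\<close>

lemma eqv_alt: "eqv (alt (n + 10) a b) (alt (n + 8) a b)"
proof -
  have *: "alt (n + 10) a b = alt 10 a b @ alt n a b" "alt (n + 8) a b = alt 8 a b @ alt n a b"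
    by (simp_all add: eval_nat_numeral)
  have "rev (alt 10 a b) = alt 10 b a" "rev (alt 8 a b) = alt 8 b a"
    by (simp_all add: eval_nat_numeral)
  with * show ?thesis
    unfolding eqv_def by (simp add: pump10D valid_act del: split_paired_All)
qed

lemma set_pats: "alt n a b \<in> set (pats x)" if "0 < n" "n < 10" "a \<noteq> b" "x \<noteq> a" "x \<noteq> b"
proof -
  have "(a, b) \<in> set (others x)" using that(3-5) by (cases x; cases a; cases b) simp_all
  moreover have "n \<in> set [1..<10]" using that by simp
  ultimately show ?thesis unfolding pats_def by force
qed

lemma pats_alt:
  assumes "0 < n" "a \<noteq> b" "x \<noteq> a" "x \<noteq> b"
  shows "\<exists>p' \<in> set (pats x). eqv (alt n a b) p'"
  using assms(1)
proof (induction n rule: less_induct)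
  case (less n)
  show ?case
  proof (cases "n < 10")
    case True
    then show ?thesis using set_pats[of n a b x] less.prems assms by (auto intro!: bexI[of _ "alt n a b"])
  next
    case False
    then have "n - 10 + 10 = n" "n - 10 + 8 = n - 2" by arith+
    then have "eqv (alt n a b) (alt (n - 2) a b)" using eqv_alt[of "n - 10" a b] by metis
    moreover obtain p' where "p' \<in> set (pats x)" "eqv (alt (n - 2) a b) p'"
      using less.IH[of "n - 2"] False by auto
    ultimately show ?thesis by (blast intro: eqv_trans)
  qed
qed

lemma two_letters_alt:
  assumes "distinct_adj p" "x \<notin> set p" "p \<noteq> []"
  shows "\<exists>n a b. p = alt n a b \<and> 0 < n \<and> a \<noteq> b \<and> x \<noteq> a \<and> x \<noteq> (b :: ltr)"
  using assms
proof (induction p)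
  case (Cons c p)
  show ?case
  proof (cases p)
    case Nil
    have "(L0 \<noteq> c \<and> L0 \<noteq> x) \<or> (L1 \<noteq> c \<and> L1 \<noteq> x) \<or> (L2 \<noteq> c \<and> L2 \<noteq> x)"
      by (cases c; cases x) simp_all
    then obtain b where "b \<noteq> c" "b \<noteq> x" by blast
    then have "c # p = alt (Suc 0) c b" "c \<noteq> b" "x \<noteq> c" "x \<noteq> b" using Nil Cons.prems by auto
    then show ?thesis by blast
  next
    case (Cons d p')
    obtain n a b where n: "p = alt n a b" "0 < n" "a \<noteq> b" "x \<noteq> a" "x \<noteq> b"
      using Cons.IH Cons.prems Cons by auto
    have "d = a" using n(1,2) Cons by (cases n) auto
    moreover have "c \<noteq> d" "c \<noteq> x" using Cons.prems Cons by auto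
    ultimately have "c = b" using n(3-5) by (cases a; cases b; cases c; cases x) simp_all
    then have "c # p = alt (Suc n) b a" using n(1) by simp
    then show ?thesis using n(3-5) by blast
  qed
qed simp

lemma pats_cover:
  assumes "distinct_adj p" "x \<notin> set p" "p \<noteq> []"
  shows "\<exists>p' \<in> set (pats x). eqv p p'"
  using two_letters_alt[OF assms] pats_alt by blast

section \<open>From the finite checks to all words\<close>

definition shrinks :: "ltr list \<Rightarrow> ltr list \<Rightarrow> bool" where
  "shrinks r t \<longleftrightarrow> (\<exists>x u v. r = x # u @ x # v \<and> t = rev u @ x # v)"

lemma word_segment:
  assumes "word (x # p @ x # v)"
  shows "p \<noteq> []" "distinct_adj p" "word (x # v)"
  using assms by (auto simp: word_def distinct_adj_Cons distinct_adj_append_iff)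

lemma run_in_sts: "run (x # v) \<in> set (sts x)"
  using valid_run[of "x # v"] by (simp add: valid_def)

lemma preI:
  assumes "p' \<in> set (pats x)" "eqv p p'"
  shows "(p', run (x # v)) \<in> set (pre x (run (x # p @ x # v)))"
proof -
  have "tr x (act p' (run (x # v))) = run (x # p @ x # v)"
    using eqv_act[OF assms(2), of "x # v"] by (simp add: run_append)
  then show ?thesis using assms(1) run_in_sts[of x v] unfolding pre_def by auto
qed

lemma first_split:
  assumes "w @ x # v2 = v"
  obtains p v' where "x \<notin> set p" "v = p @ x # v'" "w = p \<or> (\<exists>w'. w = p @ x # w')"
proof -
  have "x \<in> set v" using assms by auto
  then obtain p v' where pv: "v = p @ x # v'" "x \<notin> set p" by (meson split_list_first)
  then have "w @ x # v2 = p @ x # v'" using assms by simp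
  then have "w = p \<or> (\<exists>w'. w = p @ x # w')"
    using pv(2) by (auto simp: append_eq_append_conv2 Cons_eq_append_conv append_eq_Cons_conv)
  with pv that show ?thesis by blast
qed

lemma chk_rareD:
  assumes "chk_rare k x u q" "kind_of (tr x (act u q)) = Rare"
  shows "excess (act (rev u) q) \<noteq> 0"
    and "(p, q') \<in> set (pre x q) \<Longrightarrow> \<exists>k'. k = Suc k' \<and> chk_rare k' x (u @ x # p) q'"
proof -
  have c: "excess (act (rev u) q) \<noteq> 0 \<and> (\<forall>(p, q') \<in> set (pre x q).
      case k of 0 \<Rightarrow> False | Suc k' \<Rightarrow> chk_rare k' x (u @ x # p) q')"
    using assms unfolding chk_rare.simps[of k] list_all_iff by (simp split: if_splits)
  then show "excess (act (rev u) q) \<noteq> 0" by blast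
  assume "(p, q') \<in> set (pre x q)"
  then have "case k of 0 \<Rightarrow> False | Suc k' \<Rightarrow> chk_rare k' x (u @ x # p) q'" using c by blast
  then show "\<exists>k'. k = Suc k' \<and> chk_rare k' x (u @ x # p) q'" by (cases k) simp_all
qed

text \<open>The check runs on a representative \<open>u'\<close> of \<open>u\<close>. The induction
  moves the cut to the next \<open>x\<close>; the actual continuation is among the pairs in
  \<open>pre\<close>, so every later cut \<open>u2\<close> is covered as well.\<close>

lemma chk_rare_sound:
  assumes "chk_rare k x u' (run (x # v))" "eqv u u'" "word (x # u @ x # v)"
    and "kind_of (run (x # u @ x # v)) = Rare"
    and "u2 @ x # v2 = u @ x # v" "u2 = u \<or> (\<exists>w. u2 = u @ x # w)"
  shows "excess (run (rev u2 @ x # v2)) \<noteq> 0"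
  using assms
proof (induction k arbitrary: u u' v rule: less_induct)
  case (less k)
  have "kind_of (tr x (act u' (run (x # v)))) = Rare"
    using less.prems(4) eqv_act[OF less.prems(2), of "x # v"] by (simp add: run_append)
  note D = chk_rareD[OF less.prems(1) this]
  from less.prems(6) show ?case
  proof
    assume "u2 = u"
    then show ?thesis
      using less.prems(5) D(1) eqv_act_rev[OF less.prems(2), of "x # v"]
      by (simp add: run_append del: run_Cons)
  next
    assume "\<exists>w. u2 = u @ x # w"
    then obtain w where w: "u2 = u @ x # w" by blast
    then have "w @ x # v2 = v" using less.prems(5) by simp
    then obtain p v' where p: "x \<notin> set p" "v = p @ x # v'" "w = p \<or> (\<exists>w'. w = p @ x # w')"
      by (rule first_split)
    have "word ((x # u) @ x # p @ x # v')" using less.prems(3) p(2) by simp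
    then have "word (x # p @ x # v')" by (rule word_append[rotated]) simp
    note seg = word_segment[OF this]
    obtain p' where p': "p' \<in> set (pats x)" "eqv p p'" using pats_cover[OF seg(2) p(1) seg(1)] by blast
    obtain k' where k': "k = Suc k'" "chk_rare k' x (u' @ x # p') (run (x # v'))"
      using D(2) preI[OF p', of v'] p(2) by blast
    show ?thesis
    proof (rule less.IH[OF _ k'(2) eqv_append[OF p'(2) less.prems(2)]])
      show "k' < k" using k'(1) by simp
      show "word (x # (u @ x # p) @ x # v')" using less.prems(3) p(2) by simp
      show "kind_of (run (x # (u @ x # p) @ x # v')) = Rare" using less.prems(4) p(2) by simp
      show "u2 @ x # v2 = (u @ x # p) @ x # v'" using less.prems(5) p(2) by simp
      show "u2 = u @ x # p \<or> (\<exists>wa. u2 = (u @ x # p) @ x # wa)" using p(3) w by auto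
    qed
  qed
qed

lemma chk_goodD:
  assumes "chk_good k x u q" "reducible (tr x (act u q))"
    and "excess (act (rev u) q) \<noteq> excess (tr x (act u q))"
  shows "q \<notin> set (terms x)"
    and "(p, q') \<in> set (pre x q) \<Longrightarrow> \<exists>k'. k = Suc k' \<and> chk_good k' x (u @ x # p) q'"
proof -
  have c: "q \<notin> set (terms x) \<and> (case k of 0 \<Rightarrow> False
      | Suc k' \<Rightarrow> (\<forall>(p, q') \<in> set (pre x q). chk_good k' x (u @ x # p) q'))"
    using assms unfolding chk_good.simps[of k] list_all_iff Let_def by (simp split: if_splits)
  then show "q \<notin> set (terms x)" by blast
  assume "(p, q') \<in> set (pre x q)"
  then show "\<exists>k'. k = Suc k' \<and> chk_good k' x (u @ x # p) q'" using c by (cases k) auto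
qed

lemma run_terms:
  assumes "word (x # v)" "x \<notin> set v"
  shows "run (x # v) \<in> set (terms x)"
proof (cases "v = []")
  case True
  then show ?thesis using assms by (simp add: word_single)
next
  case False
  then have l: "distinct_adj v" "last v = L2" using assms by (auto simp: word_def distinct_adj_Cons)
  then have "x \<noteq> L2" using assms(2) False last_in_set by metis
  obtain p' where p': "p' \<in> set (pats x)" "eqv v p'" using pats_cover[OF l(1) assms(2) False] by blast
  have "run (x # v) = tr x (act p' q_2)"
    using eqv_act[OF p'(2), of "[]"] by (simp add: run_def)
  then show ?thesis using p'(1) \<open>x \<noteq> L2\<close> by (cases x) auto
qed

text \<open>If the current cut fails, the test against \<open>terms\<close> shows that
  \<open>x\<close> occurs once more, so the cut can move on; the depth bound forces some cut to
  succeed.\<close>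

lemma chk_good_sound:
  assumes "chk_good k x u' (run (x # v))" "eqv u u'" "word (x # u @ x # v)"
    and "reducible (run (x # u @ x # v))"
  shows "\<exists>u2 v2. u2 @ x # v2 = u @ x # v \<and>
    excess (run (rev u2 @ x # v2)) = excess (run (x # u @ x # v))"
  using assms
proof (induction k arbitrary: u u' v rule: less_induct)
  case (less k)
  have r: "tr x (act u' (run (x # v))) = run (x # u @ x # v)"
    using eqv_act[OF less.prems(2), of "x # v"] by (simp add: run_append)
  have t: "act (rev u') (run (x # v)) = run (rev u @ x # v)"
    using eqv_act_rev[OF less.prems(2), of "x # v"] by (simp add: run_append)
  show ?case
  proof (cases "excess (run (rev u @ x # v)) = excess (run (x # u @ x # v))")
    case True
    then show ?thesis by blast
  next
    case False
    then have "excess (act (rev u') (run (x # v))) \<noteq> excess (tr x (act u' (run (x # v))))"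
      by (simp only: r t not_False_eq_True)
    moreover have "reducible (tr x (act u' (run (x # v))))" using less.prems(4) by (simp only: r)
    ultimately have D: "run (x # v) \<notin> set (terms x)"
      "\<And>p q'. (p, q') \<in> set (pre x (run (x # v))) \<Longrightarrow> \<exists>k'. k = Suc k' \<and> chk_good k' x (u' @ x # p) q'"
      using chk_goodD[OF less.prems(1)] by blast+
    have "word ((x # u) @ x # v)" using less.prems(3) by simp
    then have "word (x # v)" by (rule word_append[rotated]) simp
    then have "x \<in> set v" using D(1) run_terms by blast
    then obtain p v' where p: "v = p @ x # v'" "x \<notin> set p" by (meson split_list_first)
    note seg = word_segment[OF \<open>word (x # v)\<close>[unfolded p(1)]]
    obtain p' where p': "p' \<in> set (pats x)" "eqv p p'" using pats_cover[OF seg(2) p(2) seg(1)] by blast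
    obtain k' where k': "k = Suc k'" "chk_good k' x (u' @ x # p') (run (x # v'))"
      using D(2) preI[OF p', of v'] p(1) by blast
    have "\<exists>u2 v2. u2 @ x # v2 = (u @ x # p) @ x # v' \<and>
      excess (run (rev u2 @ x # v2)) = excess (run (x # (u @ x # p) @ x # v'))"
    proof (rule less.IH[OF _ k'(2) eqv_append[OF p'(2) less.prems(2)]])
      show "k' < k" using k'(1) by simp
      show "word (x # (u @ x # p) @ x # v')" using less.prems(3) p(1) by simp
      show "reducible (run (x # (u @ x # p) @ x # v'))" using less.prems(4) p(1) by simp
    qed
    then show ?thesis using p(1) by simp
  qed
qed

lemma list_all2D: "list_all (\<lambda>q. list_all (P q) A) B \<Longrightarrow> p \<in> set A \<Longrightarrow> q \<in> set B \<Longrightarrow> P q p"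
  by (auto simp: list_all_iff)

lemma shrinks_segment:
  assumes "word r" "shrinks r t"
  obtains x p v where "r = x # p @ x # v" "x \<notin> set p" "distinct_adj p" "p \<noteq> []"
    "\<exists>u2 v2. u2 @ x # v2 = p @ x # v \<and> t = rev u2 @ x # v2 \<and> (u2 = p \<or> (\<exists>w. u2 = p @ x # w))"
proof -
  obtain x u v where r: "r = x # u @ x # v" "t = rev u @ x # v" using assms(2) by (auto simp: shrinks_def)
  obtain p v' where p: "x \<notin> set p" "u @ x # v = p @ x # v'" "u = p \<or> (\<exists>w'. u = p @ x # w')"
    by (rule first_split[OF refl])
  have "r = x # p @ x # v'" using r(1) p(2) by simp
  moreover note word_segment[OF assms(1)[unfolded this]]
  ultimately show ?thesis using that[of x p v'] p r(2) by blast
qed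

lemma shrinks_Rare:
  assumes "word r" "kind_of (run r) = Rare" "shrinks r t"
  shows "excess (run t) \<noteq> 0"
proof -
  obtain x p v where r: "r = x # p @ x # v" "x \<notin> set p" "distinct_adj p" "p \<noteq> []"
    and "\<exists>u2 v2. u2 @ x # v2 = p @ x # v \<and> t = rev u2 @ x # v2 \<and> (u2 = p \<or> (\<exists>w. u2 = p @ x # w))"
    using shrinks_segment[OF assms(1,3)] .
  then obtain u2 v2 where t: "u2 @ x # v2 = p @ x # v" "t = rev u2 @ x # v2" "u2 = p \<or> (\<exists>w. u2 = p @ x # w)"
    by blast
  obtain p' where p': "p' \<in> set (pats x)" "eqv p p'" using pats_cover[OF r(3,2,4)] by blast
  have "chk_rare 5 x p' (run (x # v))" using list_all2D[OF chk_rare_all p'(1) run_in_sts] .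
  from chk_rare_sound[OF this p'(2)] show ?thesis using assms(1,2) r(1) t by blast
qed

lemma shrinks_exists:
  assumes "word (x # w)" "reducible (run (x # w))" "x \<in> set w"
  shows "\<exists>t. shrinks (x # w) t \<and> excess (run t) = excess (run (x # w))"
proof -
  obtain p v where p: "w = p @ x # v" "x \<notin> set p" using assms(3) by (meson split_list_first)
  note seg = word_segment[OF assms(1)[unfolded p(1)]]
  obtain p' where p': "p' \<in> set (pats x)" "eqv p p'" using pats_cover[OF seg(2) p(2) seg(1)] by blast
  have "chk_good 3 x p' (run (x # v))" using list_all2D[OF chk_good_all p'(1) run_in_sts] .
  from chk_good_sound[OF this p'(2)] obtain u2 v2 where "u2 @ x # v2 = p @ x # v"
    "excess (run (rev u2 @ x # v2)) = excess (run (x # w))"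
    using assms(1,2) unfolding p(1) by blast
  then show ?thesis unfolding shrinks_def p(1) by metis
qed

section \<open>Reductions and the excess\<close>

fun adjs :: "'a list \<Rightarrow> ('a \<times> 'a) set" where
  "adjs (x # y # r) = {(x, y), (y, x)} \<union> adjs (y # r)"
| "adjs _ = {}"

lemma adjs_append:
  "adjs (u @ v) = adjs u \<union> adjs v \<union>
     (if u = [] \<or> v = [] then {} else {(last u, hd v), (hd v, last u)})"
proof (induction u rule: adjs.induct)
  case ("2_2" x)
  then show ?case by (cases v) auto
qed auto

lemma adjs_Cons: "adjs (c # v) = adjs v \<union> (if v = [] then {} else {(c, hd v), (hd v, c)})"
  using adjs_append[of "[c]" v] by auto

lemma adjs_rev [simp]: "adjs (rev u) = adjs u"
  by (induction u) (auto simp: adjs_append adjs_Cons last_rev hd_rev)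

text \<open>The only new contact is between \<open>hd u\<close> and the second \<open>x\<close>, and
  \<open>hd u\<close> already stood next to the first \<open>x\<close>.\<close>

lemma adjs_shrinks: "shrinks r t \<Longrightarrow> adjs t \<subseteq> adjs r"
  by (auto simp: shrinks_def adjs_append adjs_Cons last_rev hd_rev split: if_splits)

text \<open>The stage before \<open>End_12\<close> when reading from the right: no further
  \<open>L2\<close> has been seen yet.\<close>

definition Pre12 :: "ltr list \<Rightarrow> bool" where
  "Pre12 r \<longleftrightarrow> (\<exists>u. r = u @ [L1, L2] \<and> L2 \<notin> set u \<and> (u = [] \<or> last u = L0))"

definition End_12 :: "ltr list \<Rightarrow> bool" where
  "End_12 r \<longleftrightarrow> (\<exists>u. r = u @ [L1, L2] \<and> L2 \<in> set u \<and> last u = L0 \<and> (L1, L2) \<notin> adjs u)"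

definition End_212 :: "ltr list \<Rightarrow> bool" where
  "End_212 r \<longleftrightarrow> (\<exists>u. r = u @ [L2, L1, L2] \<and> u \<noteq> [] \<and> L2 \<notin> set u \<and> last u = L0)"

text \<open>Positive excess explained by the letters alone. This class is closed under reductions
  and contains every word of positive excess outside \<open>Rare\<close>.\<close>

definition flat :: "ltr list \<Rightarrow> bool" where
  "flat r \<longleftrightarrow> (L0, L1) \<notin> adjs r \<or> (L1, L2) \<notin> adjs r \<or> End_12 r \<or> End_212 r"

lemma joins_adjs: "r \<noteq> [] \<Longrightarrow> (a, b) \<in> adjs (c # r) \<longleftrightarrow> (a, b) \<in> adjs r \<or> joins a b c (fst (run r))"
  by (auto simp: adjs_Cons joins_def fst_run)

lemma no01_iff: "word r \<Longrightarrow> no01 (run r) \<longleftrightarrow> (L0, L1) \<notin> adjs r"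
proof (induction r)
  case (Cons c r)
  show ?case
  proof (cases "r = []")
    case True
    then show ?thesis using Cons.prems by (simp add: word_single no01_def)
  next
    case False
    then show ?thesis
      using Cons word_trans[OF no01_tr Cons.prems False] joins_adjs[OF False, of L0 L1 c]
      by (simp add: word_Cons)
  qed
qed (simp add: word_def)

lemma no12_iff: "word r \<Longrightarrow> no12 (run r) \<longleftrightarrow> (L1, L2) \<notin> adjs r"
proof (induction r)
  case (Cons c r)
  show ?case
  proof (cases "r = []")
    case True
    then show ?thesis using Cons.prems by (simp add: word_single no12_def)
  next
    case False
    then show ?thesis
      using Cons word_trans[OF no12_tr Cons.prems False] joins_adjs[OF False, of L1 L2 c]
      by (simp add: word_Cons)
  qed
qed (simp add: word_def)

lemma run_eq_q_2: "word r \<Longrightarrow> run r = q_2 \<longleftrightarrow> r = [L2]"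
  by (rule iffI, erule (1) run_q_2, simp)

lemma run_eq_q_212: "word r \<Longrightarrow> run r = q_212 \<longleftrightarrow> r = [L2, L1, L2]"
  by (rule iffI, erule (1) run_q_212, simp)

lemma pre12_Pre12: "word r \<Longrightarrow> pre12 (run r) \<Longrightarrow> Pre12 r"
proof (induction r)
  case (Cons c r)
  show ?case
  proof (cases "r = []")
    case True
    then show ?thesis using Cons.prems by (simp add: word_single pre12_def)
  next
    case False
    then have r: "word r" "c \<noteq> hd r" using Cons.prems by (simp_all add: word_Cons)
    have t: "if run r = q_2 then c = L1 else pre12 (run r) \<and> c \<noteq> L2"
      using word_trans[OF pre12_tr Cons.prems(1) False] Cons.prems(2) by (simp only: run_Cons)
    show ?thesis
    proof (cases "r = [L2]")
      case True
      then show ?thesis using t by (simp add: Pre12_def)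
    next
      case False
      then have "pre12 (run r)" "c \<noteq> L2" using t run_eq_q_2[OF r(1)] by (simp_all split: if_splits)
      then obtain u where u: "r = u @ [L1, L2]" "L2 \<notin> set u" "u = [] \<or> last u = L0"
        using Cons.IH[OF r(1)] by (auto simp: Pre12_def)
      then have "u = [] \<Longrightarrow> c = L0" using r(2) \<open>c \<noteq> L2\<close> by (cases c) auto
      then show ?thesis using u \<open>c \<noteq> L2\<close> unfolding Pre12_def by (intro exI[of _ "c # u"]) auto
    qed
  qed
qed (simp add: word_def)

lemma Pre12_pre12: "word (u @ [L1, L2]) \<Longrightarrow> L2 \<notin> set u \<Longrightarrow> pre12 (run (u @ [L1, L2]))"
proof (induction u)
  case (Cons c u)
  let ?r = "u @ [L1, L2]"
  have "word ?r" using Cons.prems(1) by (simp add: word_Cons)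
  moreover have "c \<noteq> L2" using Cons.prems(2) by auto
  ultimately show ?case
    using word_trans[OF pre12_tr, of c ?r] Cons run_eq_q_2[of ?r] by simp
qed (simp add: pre12_def)

lemma end12_End_12: "word r \<Longrightarrow> end12 (run r) \<Longrightarrow> End_12 r"
proof (induction r)
  case (Cons c r)
  show ?case
  proof (cases "r = []")
    case True
    then show ?thesis using Cons.prems by (simp add: word_single end12_def)
  next
    case False
    then have r: "word r" "c \<noteq> hd r" "fst (run r) = hd r" using Cons.prems by (simp_all add: word_Cons fst_run)
    have "end12 (run r) \<and> \<not> joins L1 L2 c (hd r) \<or> pre12 (run r) \<and> c = L2 \<and> hd r = L0"
      using word_trans[OF end12_tr Cons.prems(1) False] Cons.prems(2) r(3) by (simp only: run_Cons)
    then show ?thesis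
    proof (elim disjE conjE)
      assume "end12 (run r)" "\<not> joins L1 L2 c (hd r)"
      then obtain u where u: "r = u @ [L1, L2]" "L2 \<in> set u" "last u = L0" "(L1, L2) \<notin> adjs u"
        using Cons.IH[OF r(1)] by (auto simp: End_12_def)
      moreover have "u \<noteq> []" using u(2) by auto
      ultimately show ?thesis using \<open>\<not> joins L1 L2 c (hd r)\<close> unfolding End_12_def
        by (intro exI[of _ "c # u"]) (auto simp: adjs_Cons joins_def)
    next
      assume "pre12 (run r)" "c = L2" "hd r = L0"
      then obtain u where u: "r = u @ [L1, L2]" "L2 \<notin> set u" "u = [] \<or> last u = L0"
        using pre12_Pre12[OF r(1)] by (auto simp: Pre12_def)
      moreover have "u \<noteq> []" using u(1) \<open>hd r = L0\<close> by auto
      moreover have "(L1, L2) \<notin> adjs u" using u(2)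
        by (induction u rule: adjs.induct) auto
      ultimately show ?thesis using \<open>c = L2\<close> \<open>hd r = L0\<close> unfolding End_12_def
        by (intro exI[of _ "c # u"]) (auto simp: adjs_Cons)
    qed
  qed
qed (simp add: word_def)

lemma End_12_end12:
  "word (u @ [L1, L2]) \<Longrightarrow> L2 \<in> set u \<Longrightarrow> last u = L0 \<Longrightarrow> (L1, L2) \<notin> adjs u \<Longrightarrow>
    end12 (run (u @ [L1, L2]))"
proof (induction u)
  case (Cons c u)
  let ?r = "u @ [L1, L2]"
  have u: "u \<noteq> []" using Cons.prems(2,3) by auto
  have r: "word ?r" "c \<noteq> hd u" using Cons.prems(1) u by (simp_all add: word_Cons)
  have t: "end12 (run (c # ?r)) \<longleftrightarrow>
      end12 (run ?r) \<and> \<not> joins L1 L2 c (hd u) \<or> pre12 (run ?r) \<and> c = L2 \<and> hd u = L0"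
    using word_trans[OF end12_tr, of c ?r] Cons.prems(1) u fst_run[of ?r] by simp
  have a: "(L1, L2) \<notin> adjs u" "\<not> joins L1 L2 c (hd u)"
    using Cons.prems(4) u by (auto simp: adjs_Cons joins_def)
  show ?case
  proof (cases "L2 \<in> set u")
    case True
    then show ?thesis using Cons.IH[OF r(1)] a Cons.prems(3) u t by simp
  next
    case False
    then have "c = L2" using Cons.prems(2) by simp
    moreover have "hd u = L0" using a(2) r(2) \<open>c = L2\<close> by (cases "hd u") (simp_all add: joins_def)
    ultimately show ?thesis using Pre12_pre12[OF r(1) False] t by simp
  qed
qed simp

lemma end212_End_212: "word r \<Longrightarrow> end212 (run r) \<Longrightarrow> End_212 r"
proof (induction r)
  case (Cons c r)
  show ?case
  proof (cases "r = []")
    case True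
    then show ?thesis using Cons.prems by (simp add: word_single end212_def)
  next
    case False
    then have r: "word r" using Cons.prems by (simp add: word_Cons)
    have t: "if run r = q_212 then c = L0 else end212 (run r) \<and> c \<noteq> L2"
      using word_trans[OF end212_tr Cons.prems(1) False] Cons.prems(2) by (simp only: run_Cons)
    show ?thesis
    proof (cases "r = [L2, L1, L2]")
      case True
      then show ?thesis using t run_eq_q_212[OF r] unfolding End_212_def
        by (intro exI[of _ "[L0]"]) (simp split: if_splits)
    next
      case False
      then have "end212 (run r)" "c \<noteq> L2" using t run_eq_q_212[OF r] by (simp_all split: if_splits)
      then obtain u where "r = u @ [L2, L1, L2]" "u \<noteq> []" "L2 \<notin> set u" "last u = L0"
        using Cons.IH[OF r] by (auto simp: End_212_def)
      then show ?thesis using \<open>c \<noteq> L2\<close> unfolding End_212_def by (intro exI[of _ "c # u"]) auto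
    qed
  qed
qed (simp add: word_def)

lemma End_212_end212:
  "word (u @ [L2, L1, L2]) \<Longrightarrow> u \<noteq> [] \<Longrightarrow> L2 \<notin> set u \<Longrightarrow> last u = L0 \<Longrightarrow>
    end212 (run (u @ [L2, L1, L2]))"
proof (induction u)
  case (Cons c u)
  let ?r = "u @ [L2, L1, L2]"
  have r: "word ?r" using Cons.prems(1) by (simp add: word_Cons)
  have "c \<noteq> L2" using Cons.prems(3) by auto
  then show ?case
    using word_trans[OF end212_tr, of c ?r] Cons r run_eq_q_212[of ?r] by (cases "u = []") simp_all
qed simp

lemma flat_excess: "word r \<Longrightarrow> flat r \<Longrightarrow> excess (run r) \<noteq> 0"
  using no01_iff[of r] no12_iff[of r] End_12_end12 End_212_end212
  unfolding flat_def End_12_def End_212_def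
  by (fastforce simp: no01_def no12_def end12_def end212_def)

lemma excess_flat:
  assumes "word r" "excess (run r) \<noteq> 0" "kind_of (run r) \<noteq> Rare"
  shows "flat r"
proof -
  have "no01 (run r) \<or> no12 (run r) \<or> end12 (run r) \<or> end212 (run r)"
    using assms(2,3) by (cases "kind_of (run r)") (simp_all add: no01_def no12_def end12_def end212_def)
  then show ?thesis using no01_iff no12_iff end12_End_12 end212_End_212 assms(1) unfolding flat_def by blast
qed

lemma word_shrinks:
  assumes "word r" "shrinks r t"
  shows "word t"
  using assms by (auto simp: shrinks_def word_def distinct_adj_Cons distinct_adj_append_iff last_rev split: if_splits)

lemma append_eq_suffix:
  assumes "x # p @ x # v = u @ s" "length s \<le> length v"
  obtains v' where "v = v' @ s" "u = x # p @ x # v'"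
proof -
  have "(x # p @ [x]) @ v = u @ s" using assms(1) by simp
  then obtain us where "x # p @ [x] = u @ us \<and> us @ v = s \<or> (x # p @ [x]) @ us = u \<and> v = us @ s"
    unfolding append_eq_append_conv2 by blast
  then show ?thesis
  proof (elim disjE conjE)
    assume a: "x # p @ [x] = u @ us" "us @ v = s"
    then have "length us + length v = length s" by auto
    then have "length us = 0" using assms(2) by linarith
    then have "us = []" by simp
    then show ?thesis using a that[of "[]"] by simp
  qed (use that in simp)
qed

text \<open>The 12 at the end is the only one. It survives unless the cut is right before the final
  \<open>L2\<close>; then the last \<open>L1\<close> moves to the front, away from it.\<close>

lemma End_12_shrinks:
  assumes r: "word r" "End_12 r" "shrinks r t"
  shows "End_12 t \<or> (L1, L2) \<notin> adjs t"
proof -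
  obtain u where u: "r = u @ [L1, L2]" "L2 \<in> set u" "last u = L0" "(L1, L2) \<notin> adjs u"
    using r(2) by (auto simp: End_12_def)
  obtain x p v where x: "r = x # p @ x # v" "t = rev p @ x # v" using r(3) by (auto simp: shrinks_def)
  have "u \<noteq> []" using u(2) by auto
  then obtain w where w: "u = x # w" using x(1) u(1) by (cases u) auto
  have hd_r: "hd u = x" using w by simp
  consider "v = []" | y where "v = [y]" | "2 \<le> length v"
    by (cases v; cases "tl v") (auto simp: Suc_le_eq)
  then show ?thesis
  proof cases
    case 1
    then have e: "x = L2" "p = w @ [L1]" using x(1) u(1) w by auto
    then have "w \<noteq> []" using u(3) w by auto
    then have l: "last w = L0" and h: "hd w \<noteq> L1" using u(3,4) w e(1) by (auto simp: adjs_Cons)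
    have "(L1, L2) \<notin> adjs w" using u(4) w by (auto simp: adjs_Cons split: if_splits)
    then have "(L1, L2) \<notin> adjs (L1 # rev w @ [L2])"
      using \<open>w \<noteq> []\<close> l h by (auto simp: adjs_Cons adjs_append hd_rev last_rev hd_append)
    then show ?thesis using x(2) e 1 by simp
  next
    case (2 y)
    then have e: "x = L1" "y = L2" "p = w" using x(1) u(1) w by auto
    then have "w \<noteq> []" using u(3) w by auto
    have "hd w \<noteq> L2" using u(4) w e(1) \<open>w \<noteq> []\<close> by (auto simp: adjs_Cons)
    moreover have "hd w \<noteq> L1" using r(1) u(1) w e(1) \<open>w \<noteq> []\<close> by (auto simp: word_def distinct_adj_Cons)
    ultimately have "hd w = L0" by (cases "hd w") simp_all
    moreover have "(L1, L2) \<notin> adjs w" using u(4) w by (auto simp: adjs_Cons split: if_splits)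
    moreover have "L2 \<in> set w" using u(2) w e(1) by simp
    ultimately have "End_12 (rev w @ [L1, L2])"
      unfolding End_12_def using \<open>w \<noteq> []\<close> by (intro exI[of _ "rev w"]) (simp add: last_rev)
    then show ?thesis using x(2) e 2 by simp
  next
    case 3
    then obtain v' where v': "v = v' @ [L1, L2]" "u = x # p @ x # v'"
      using append_eq_suffix[of x p v u "[L1, L2]"] x(1) u(1) by auto
    then have "shrinks u (rev p @ x # v')" by (auto simp: shrinks_def)
    then have "(L1, L2) \<notin> adjs (rev p @ x # v')" using adjs_shrinks u(4) by blast
    moreover have "last (rev p @ x # v') = L0" using u(3) v'(2) by simp
    moreover have "L2 \<in> set (rev p @ x # v')" using u(2) v'(2) by auto
    ultimately have "End_12 t" unfolding End_12_def using x(2) v'(1)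
      by (intro exI[of _ "rev p @ x # v'"]) simp
    then show ?thesis ..
  qed
qed

text \<open>The first letter is not \<open>L2\<close>, so the cut is inside \<open>u\<close> or
  right before the final \<open>L1\<close>. In the latter case an \<open>L2\<close> moves to the
  front and \<open>End_12\<close> results.\<close>

lemma End_212_shrinks:
  assumes r: "word r" "End_212 r" "shrinks r t"
  shows "End_212 t \<or> End_12 t"
proof -
  obtain u where u: "r = u @ [L2, L1, L2]" "u \<noteq> []" "L2 \<notin> set u" "last u = L0"
    using r(2) by (auto simp: End_212_def)
  obtain x p v where x: "r = x # p @ x # v" "t = rev p @ x # v" using r(3) by (auto simp: shrinks_def)
  obtain w where w: "u = x # w" using x(1) u(1,2) by (cases u) auto
  then have "x \<noteq> L2" using u(3) by auto
  consider "v = []" | y where "v = [y]" | y z where "v = [y, z]" | "3 \<le> length v"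
    by (cases v; cases "tl v"; cases "tl (tl v)") (auto simp: numeral_eq_Suc)
  then show ?thesis
  proof cases
    case 1
    then show ?thesis using x(1) u(1) w \<open>x \<noteq> L2\<close> by auto
  next
    case (2 y)
    then have e: "x = L1" "y = L2" "p = w @ [L2]" using x(1) u(1) w by auto
    then have "w \<noteq> []" using u(4) w by auto
    have "L2 \<notin> set w" using u(3) w by simp
    moreover from this have "hd w \<noteq> L2" using \<open>w \<noteq> []\<close> hd_in_set by metis
    moreover have "hd w \<noteq> L1" "last w = L0"
      using r(1) u w e(1) \<open>w \<noteq> []\<close> by (auto simp: word_def distinct_adj_Cons)
    moreover have "hd w = L0" using calculation by (cases "hd w") simp_all
    moreover have "(L1, L2) \<notin> adjs w" using \<open>L2 \<notin> set w\<close> by (induction w rule: adjs.induct) auto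
    ultimately have "End_12 ((L2 # rev w) @ [L1, L2])"
      unfolding End_12_def using \<open>w \<noteq> []\<close>
      by (intro exI[of _ "L2 # rev w"]) (simp add: last_rev adjs_Cons hd_rev)
    then show ?thesis using x(2) e 2 by simp
  next
    case (3 y z)
    then show ?thesis using x(1) u(1) w \<open>x \<noteq> L2\<close> by auto
  next
    case 4
    then obtain v' where v': "v = v' @ [L2, L1, L2]" "u = x # p @ x # v'"
      using append_eq_suffix[of x p v u "[L2, L1, L2]"] x(1) u(1) by auto
    then have "last (rev p @ x # v') = L0" "L2 \<notin> set (rev p @ x # v')" using u(3,4) by auto
    then have "End_212 t" unfolding End_212_def using x(2) v'(1)
      by (intro exI[of _ "rev p @ x # v'"]) simp
    then show ?thesis ..
  qed
qed

text \<open>Words of excess 2 are \<open>Tiny\<close> and have no reduction, so only a drop from 1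
  to 0 has to be excluded: by the search for \<open>Rare\<close>, by closure of \<open>flat\<close>
  otherwise.\<close>

lemma excess_shrinks:
  assumes "word r" "shrinks r t"
  shows "excess (run r) \<le> excess (run t)"
proof -
  have le1: "excess (run r) \<le> 1" if "kind_of (run r) \<noteq> Tiny"
    using that by (cases "kind_of (run r)") simp_all
  have nT: "kind_of (run r) \<noteq> Tiny"
  proof
    assume "kind_of (run r) = Tiny"
    then have "r = [L2] \<or> r = [L0, L2, L1, L2]" using Tiny_word assms(1) by blast
    moreover have "hd r \<in> set (tl r)" using assms(2) by (auto simp: shrinks_def)
    ultimately show False by auto
  qed
  have "excess (run t) \<noteq> 0" if "excess (run r) \<noteq> 0"
  proof (cases "kind_of (run r) = Rare")
    case True
    then show ?thesis using shrinks_Rare assms by blast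
  next
    case False
    then have "flat r" using excess_flat assms(1) that by blast
    then have "flat t" unfolding flat_def
      using adjs_shrinks[OF assms(2)] End_12_shrinks[OF assms(1) _ assms(2)]
        End_212_shrinks[OF assms(1) _ assms(2)] by blast
    then show ?thesis using flat_excess word_shrinks assms by blast
  qed
  then show ?thesis using le1[OF nT] by (cases "excess (run r) = 0") auto
qed

section \<open>Words whose first letter does not recur\<close>

lemma chk_single_alt:
  assumes "(a, b) \<in> set (others x)" "x \<noteq> L2" "0 < n" "last (alt n a b) = L2"
  shows "n = 1 \<or> x = L0 \<and> n = 2 \<and> a = L1 \<or> chk_single x a b n"
  using assms(3,4)
proof (induction n rule: less_induct)
  case (less n)
  show ?case
  proof (cases "n < 14")
    case True
    have "x \<in> set [L0, L1]" using assms(2) by (cases x) simp_all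
    from list_allD[OF chk_single_all this] have
      "\<forall>(a, b) \<in> set (others x). \<forall>n \<in> set [1..<14]. last (alt n a b) \<noteq> L2 \<or> n = 1 \<or> (x, n) = (L0, 2) \<and> a = L1 \<or>
        chk_single x a b n" unfolding list_all_iff .
    moreover have "n \<in> set [1..<14]" using True less.prems(1) by simp
    ultimately show ?thesis using assms(1) less.prems(2) by blast
  next
    case False
    \<comment> \<open>From 14 on, all of \<open>n\<close>, \<open>n - 1\<close> and
      \<open>n - 2\<close> are at least 10, so the three alternations in \<open>chk_single\<close>
      may each lose two letters.\<close>
    then have n: "n - 2 + 2 = n" "n - 2 < n" "0 < n - 2" "12 \<le> n - 2" by arith+
    have "alt n a b = a # b # alt (n - 2) a b"
      using n(1) by (metis alt.simps(2) add_2_eq_Suc')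
    moreover have "alt (n - 2) a b \<noteq> []" using n(3) by (cases "n - 2") simp_all
    ultimately have "last (alt (n - 2) a b) = L2" using less.prems(2) by simp
    from less.IH[OF n(2,3) this] have "chk_single x a b (n - 2)" using n(4) by auto
    moreover have s: "act (alt m c d) q_2 = act (alt (m - 2) c d) q_2" if "10 \<le> m" for m c d
    proof -
      have "m - 10 + 10 = m" "m - 10 + 8 = m - 2" using that by arith+
      then show ?thesis using eqv_act[OF eqv_alt[of "m - 10" c d], of "[]"] by (simp only: run_Nil)
    qed
    moreover have e: "10 \<le> n" "10 \<le> n - 1" "10 \<le> n - 2" "n - 1 - 2 = n - 2 - 1" using n(4) by arith+
    moreover note s[OF e(1), of a b] s[OF e(2), of b a, unfolded e(4)] s[OF e(3), of a b]
    ultimately show ?thesis using n(4) unfolding chk_single_def by (simp add: Let_def)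
  qed
qed

section \<open>The sorting distance\<close>

lemma remdups_adj_append_if:
  assumes "u \<noteq> []" "v \<noteq> []"
  shows "remdups_adj (u @ v) = remdups_adj u @ (if last u = hd v then tl (remdups_adj v) else remdups_adj v)"
proof -
  obtain c v' where v: "v = c # v'" using assms(2) by (cases v) auto
  show ?thesis using assms(1) unfolding v by (simp add: remdups_adj_append'' remdups_adj_Cons')
qed

text \<open>Lifts a cut of the reduced word to a block boundary of the string, so that moves on
  reduced words are realised by flips.\<close>

lemma remdups_adj_eq_append:
  assumes "remdups_adj xs = U @ V" "U \<noteq> []" "V \<noteq> []"
  shows "\<exists>u v. xs = u @ v \<and> remdups_adj u = U \<and> remdups_adj v = V"
  using assms
proof (induction xs arbitrary: U rule: remdups_adj.induct)
  case (3 x y xs)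
  show ?case
  proof (cases "x = y")
    case True
    then obtain u v where uv: "y # xs = u @ v" "remdups_adj u = U" "remdups_adj v = V"
      using 3 by (auto simp del: append_eq_Cons_conv)
    then have "u \<noteq> []" using 3(4) by auto
    then obtain u' where "u = y # u'" using uv(1) by (cases u) auto
    then have "remdups_adj (x # u) = U" using uv(2) True by simp
    then show ?thesis using uv True by (intro exI[of _ "x # u"] exI[of _ v]) simp
  next
    case False
    then obtain U' where U': "U = x # U'" "remdups_adj (y # xs) = U' @ V"
      using 3(3,4) by (cases U) auto
    show ?thesis
    proof (cases "U' = []")
      case True
      then show ?thesis using U' by (intro exI[of _ "[x]"] exI[of _ "y # xs"]) simp
    next
      case ne: False
      then obtain u v where uv: "y # xs = u @ v" "remdups_adj u = U'" "remdups_adj v = V"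
        using 3(2)[OF False U'(2) ne 3(5)] by blast
      then have "u \<noteq> []" using ne by auto
      then obtain u' where "u = y # u'" using uv(1) by (cases u) auto
      then have "remdups_adj (x # u) = U" using uv(2) U'(1) False by simp
      then show ?thesis using uv by (intro exI[of _ "x # u"] exI[of _ v]) simp
    qed
  qed
qed (auto simp: Cons_eq_append_conv)

definition reduct :: "ltr list \<Rightarrow> ltr list" where "reduct w = remdups_adj (w @ [L2])"

lemma word_reduct [simp]: "word (reduct w)"
  by (simp add: word_def reduct_def)

lemma run_reduct [simp]: "run (reduct w) = run w"
  by (simp add: reduct_def run_def act_remdups_adj)

definition sorted_words :: "ltr list set" where
  "sorted_words = {[L2], [L0, L2], [L1, L2], [L0, L1, L2]}"

text \<open>\<open>cost (reduct w)\<close> is the sorting distance of \<open>w\<close> plus 3.\<close>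

definition cost :: "ltr list \<Rightarrow> nat" where
  "cost r = length r + excess (run r)"

text \<open>No flip can remove a block here, so the progress has to come from the excess.\<close>

lemma single_move:
  assumes "word (x # w)" "x \<notin> set w" "x # w \<notin> sorted_words"
  shows "\<exists>U V. x # w = U @ V \<and> U \<noteq> [] \<and> V \<noteq> [] \<and> hd U \<noteq> hd V \<and>
    Suc (excess (run (rev U @ V))) = excess (run (x # w))"
proof -
  have w: "w \<noteq> []" using assms(1,3) by (auto simp: word_single sorted_words_def)
  then have d: "distinct_adj w" "last w = L2" using assms(1) by (auto simp: word_def distinct_adj_Cons)
  obtain n a b where n: "w = alt n a b" "0 < n" "a \<noteq> b" "x \<noteq> a" "x \<noteq> b"
    using two_letters_alt[OF d(1) assms(2) w] by blast
  have x: "x \<noteq> L2" using assms(2) d(2) w last_in_set by metis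
  have "(a, b) \<in> set (others x)" using n(3-5) by (cases x; cases a; cases b) simp_all
  then have "n = 1 \<or> x = L0 \<and> n = 2 \<and> a = L1 \<or> chk_single x a b n"
    using chk_single_alt x n(1,2) d(2) by blast
  then consider "n = 1" | "x = L0" "n = 2" "a = L1" | "chk_single x a b n" by blast
  then show ?thesis
  proof cases
    case 1
    then show ?thesis using assms(3) d(2) n(1) x by (cases x) (simp_all add: sorted_words_def)
  next
    case 2
    then show ?thesis using assms(3) d(2) n(1) by (simp add: sorted_words_def numeral_eq_Suc)
  next
    case 3
    then have n2: "2 \<le> n" by (simp add: chk_single_def)
    let ?e = "excess (run (x # w))"
    have "Suc (excess (run ([a, x] @ alt (n - 1) b a))) = ?e \<or>
        3 \<le> n \<and> Suc (excess (run ([b, a, x] @ alt (n - 2) a b))) = ?e"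
      using 3 unfolding chk_single_def Let_def n(1) run_def by simp
    then show ?thesis
    proof (elim disjE conjE)
      assume e: "Suc (excess (run ([a, x] @ alt (n - 1) b a))) = ?e"
      obtain m where m: "n = Suc (Suc m)" using n2 by (metis add_2_eq_Suc le_Suc_ex)
      show ?thesis
        using e n unfolding m by (intro exI[of _ "[x, a]"] exI[of _ "alt (Suc m) b a"]) simp
    next
      assume "3 \<le> n" and e: "Suc (excess (run ([b, a, x] @ alt (n - 2) a b))) = ?e"
      then obtain m where m: "n = Suc (Suc (Suc m))" by (metis add_Suc numeral_3_eq_3 le_Suc_ex add_0)
      show ?thesis
        using e n unfolding m by (intro exI[of _ "[x, a, b]"] exI[of _ "alt (Suc m) a b"]) simp
    qed
  qed
qed

lemma word_move:
  assumes "word r" "r \<notin> sorted_words"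
  shows "\<exists>U V. r = U @ V \<and> U \<noteq> [] \<and> V \<noteq> [] \<and>
    (if hd U = hd V then excess (run (rev U @ tl V)) = excess (run r)
     else Suc (excess (run (rev U @ V))) = excess (run r))"
proof (cases "r = [L1, L2, L0, L1, L2]")
  case True
  \<comment> \<open>The exception in \<open>reducible\<close>: this flip removes no block, but
    lowers the excess from 1 to 0.\<close>
  have "Suc (excess (run [L2, L1, L0, L1, L2])) = excess (run [L1, L2, L0, L1, L2])" by simp
  then show ?thesis unfolding True by (intro exI[of _ "[L1, L2]"] exI[of _ "[L0, L1, L2]"]) simp
next
  case False
  obtain x w where r: "r = x # w" using assms(1) by (cases r) (auto simp: word_def)
  show ?thesis
  proof (cases "x \<in> set w")
    case True
    have "kind_of (run r) \<noteq> Tiny" using Tiny_word[OF assms(1)] True r by auto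
    moreover have "run r \<noteq> q_012" "run r \<noteq> q_12012"
      using run_q_012[OF assms(1)] run_q_12012[OF assms(1)] False assms(2)
      unfolding sorted_words_def by blast+
    ultimately have "reducible (run r)" by (simp add: reducible_def)
    then obtain t where t: "shrinks r t" "excess (run t) = excess (run r)"
      using shrinks_exists[of x w] assms(1) True r by blast
    from t(1) obtain y u v where "r = y # u @ y # v" "t = rev u @ y # v" by (auto simp: shrinks_def)
    then show ?thesis using t(2) by (intro exI[of _ "y # u"] exI[of _ "y # v"]) simp
  next
    case False
    show ?thesis
      using single_move[of x w] assms(1,2) False unfolding r by metis
  qed
qed

lemma cost_ge_3: "word r \<Longrightarrow> 3 \<le> cost r"
proof (induction rule: word_cases)
  case single
  then show ?case by (simp add: cost_def)
next
  case (Cons c r')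
  show ?case
  proof (cases rule: word_cases[OF Cons(3)])
    case 1
    then show ?thesis using Cons by (cases c) (simp_all add: cost_def)
  next
    case (2 d r'')
    then have "3 \<le> length r" using Cons(1) by (cases r'') simp_all
    then show ?thesis by (simp add: cost_def)
  qed
qed

lemma flip_append: "flip (length u) (u @ v) = rev u @ v"
  by (simp add: flip_def)

text \<open>The cut runs inside a block iff \<open>last u = hd v\<close>, and the flip joins two
  blocks iff \<open>hd u = hd v\<close>. The sentinel belongs to \<open>v\<close> and stays in
  place.\<close>

lemma reduct_flip:
  assumes "w @ [L2] = u @ v" "u \<noteq> []" "v \<noteq> []"
  shows "reduct w = remdups_adj u @ (if last u = hd v then tl (remdups_adj v) else remdups_adj v)"
    and "reduct (flip (length u) w) =
      rev (remdups_adj u) @ (if hd u = hd v then tl (remdups_adj v) else remdups_adj v)"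
proof -
  show "reduct w = remdups_adj u @ (if last u = hd v then tl (remdups_adj v) else remdups_adj v)"
    unfolding reduct_def assms(1) by (rule remdups_adj_append_if[OF assms(2,3)])
  have "w = u @ butlast v" using assms by (metis butlast_append butlast_snoc)
  then have "flip (length u) w = rev u @ butlast v" by (simp add: flip_append)
  moreover have "v = butlast v @ [L2]" using assms by (metis append_butlast_last_id last_appendR last_snoc)
  ultimately have "flip (length u) w @ [L2] = rev u @ v" by simp
  then show "reduct (flip (length u) w) =
      rev (remdups_adj u) @ (if hd u = hd v then tl (remdups_adj v) else remdups_adj v)"
    unfolding reduct_def using remdups_adj_append_if[of "rev u" v] assms(2,3) by (simp add: last_rev)
qed

lemma cost_descent:
  assumes "reduct w \<notin> sorted_words"
  shows "\<exists>i. 1 \<le> i \<and> i \<le> length w \<and> Suc (cost (reduct (flip i w))) = cost (reduct w)"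
proof -
  obtain U V where r: "reduct w = U @ V" and ne: "U \<noteq> []" "V \<noteq> []"
    and e: "if hd U = hd V then excess (run (rev U @ tl V)) = excess (run (reduct w))
     else Suc (excess (run (rev U @ V))) = excess (run (reduct w))"
    using word_move[OF word_reduct assms] by blast
  obtain u v where uv: "w @ [L2] = u @ v" "remdups_adj u = U" "remdups_adj v = V"
    using remdups_adj_eq_append[OF r[unfolded reduct_def] ne] by blast
  then have ne': "u \<noteq> []" "v \<noteq> []" using ne by auto
  have hd: "hd u = hd U" "hd v = hd V" using uv(2,3) hd_remdups_adj by metis+
  have "Suc (length w) = length u + length v" using arg_cong[OF uv(1), of length] by simp
  moreover have "1 \<le> length u" "1 \<le> length v" using ne' by (simp_all add: Suc_leI)
  ultimately have "1 \<le> length u" "length u \<le> length w" by linarith+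
  moreover have "Suc (cost (reduct (flip (length u) w))) = cost (reduct w)"
    using reduct_flip(2)[OF uv(1) ne'] e ne unfolding uv hd
    by (simp add: cost_def r split: if_splits)
  ultimately show ?thesis by blast
qed

text \<open>The length drops by at most one, and only by a reduction, which cannot lower the excess.
  If it stays, the excess drops by at most one (\<open>small\<close>); if it grows, excess at most 2
  suffices.\<close>

lemma cost_flip:
  assumes "1 \<le> i" "i \<le> length w"
  shows "cost (reduct w) \<le> Suc (cost (reduct (flip i w)))"
proof -
  define u v where "u = take i w" and "v = drop i w @ [L2]"
  have uv: "w @ [L2] = u @ v" "u \<noteq> []" "v \<noteq> []" "i = length u"
    using assms by (auto simp: u_def v_def)
  define U V where "U = remdups_adj u" and "V = remdups_adj v"
  have UV: "U \<noteq> []" "V \<noteq> []" "hd u = hd U" "last u = last U" "hd v = hd V"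
    using uv by (simp_all add: U_def V_def hd_remdups_adj)
  note R = reduct_flip[OF uv(1-3), folded uv(4) U_def V_def, unfolded UV(3-5)]
  let ?r = "reduct w" and ?t = "reduct (flip i w)"
  have le2: "excess q \<le> 2" for q by (cases "kind_of q") simp_all
  have small: "excess (run ?r) \<le> Suc (excess (run ?t))" if W: "?r = U @ W" "?t = rev U @ W" for W
  proof (rule ccontr)
    assume *: "\<not> excess (run ?r) \<le> Suc (excess (run ?t))"
    then have t: "excess (run ?t) = 0" and "excess (run ?r) = 2" using le2[of "run ?r"] by linarith+
    then have "kind_of (run ?r) = Tiny" by (cases "kind_of (run ?r)") simp_all
    then have "?r = [L2] \<or> ?r = [L0, L2, L1, L2]" using Tiny_word word_reduct by blast
    \<comment> \<open>The results of reversing a prefix of a \<open>Tiny\<close> word; reversing all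
      of \<open>0212\<close> would move the sentinel and leave \<open>L0\<close> at the end. None of
      the others has excess 0.\<close>
    then have "?t = [L2] \<or> ?t = [L0, L2, L1, L2] \<or> ?t = [L2, L0, L1, L2] \<or> ?t = [L1, L2, L0, L2] \<or> last ?t = L0"
      using W UV(1) by (auto simp: append_eq_Cons_conv Cons_eq_append_conv)
    moreover have "last ?t = L2" using word_reduct[of "flip i w"] by (simp add: word_def)
    ultimately have "?t = [L2] \<or> ?t = [L0, L2, L1, L2] \<or> ?t = [L2, L0, L1, L2] \<or> ?t = [L1, L2, L0, L2]"
      by auto
    then show False using t by (elim disjE) (simp_all only:, simp_all)
  qed
  show ?thesis
  proof (cases "last U = hd V"; cases "hd U = hd V")
    assume "last U \<noteq> hd V" "hd U = hd V"
    then obtain x U' V' where "U = x # U'" "V = x # V'" using UV(1,2) by (cases U; cases V) auto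
    then have r: "?r = x # U' @ x # V'" "?t = rev U' @ x # V'"
      using R \<open>last U \<noteq> hd V\<close> by simp_all
    then have "shrinks ?r ?t" by (auto simp: shrinks_def)
    then have "excess (run ?r) \<le> excess (run ?t)" using excess_shrinks word_reduct by blast
    then show ?thesis using r by (simp add: cost_def del: run_reduct)
  next
    assume "last U \<noteq> hd V" "hd U \<noteq> hd V"
    then show ?thesis using R small[of V] by (simp add: cost_def del: run_reduct)
  next
    assume "last U = hd V" "hd U = hd V"
    then show ?thesis using R small[of "tl V"] by (simp add: cost_def del: run_reduct)
  next
    assume "last U = hd V" "hd U \<noteq> hd V"
    then have "length ?t = Suc (length ?r)" using R UV(2) by simp
    then show ?thesis using le2[of "run ?r"] by (simp add: cost_def del: run_reduct)
  qed
qed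

section \<open>The cost modulo 3 as an automaton\<close>

fun num :: "ltr \<Rightarrow> nat" where "num L0 = 0" | "num L1 = 1" | "num L2 = 2"

lemma sorted_remdups_adj_iff: "sorted (remdups_adj xs) \<longleftrightarrow> sorted (xs :: nat list)"
  by (induction xs rule: remdups_adj.induct) auto

lemma inj_num: "inj num"
proof (rule injI)
  fix a b show "num a = num b \<Longrightarrow> a = b" by (cases a; cases b) simp_all
qed

lemma sorted_word: "word r \<Longrightarrow> sorted (map num r) \<longleftrightarrow> r \<in> sorted_words"
proof
  show "r \<in> sorted_words \<Longrightarrow> sorted (map num r)" by (auto simp: sorted_words_def)
  show "word r \<Longrightarrow> sorted (map num r) \<Longrightarrow> r \<in> sorted_words"
  proof (induction r)
    case (Cons c r)
    show ?case
    proof (cases "r = []")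
      case False
      then have "word r" "c \<noteq> hd r" "sorted (map num r)" "num c \<le> num (hd r)"
        using Cons.prems by (auto simp: word_Cons)
      then show ?thesis using Cons.IH by (cases c) (auto simp: sorted_words_def)
    qed (use Cons.prems in \<open>simp add: word_single sorted_words_def\<close>)
  qed (simp add: word_def)
qed

lemma sorted_reduct: "reduct w \<in> sorted_words \<longleftrightarrow> sorted (map num w)"
proof -
  have "num c \<le> 2" for c by (cases c) simp_all
  then have "sorted (map num w) \<longleftrightarrow> sorted (map num (w @ [L2]))" by (auto simp: sorted_append)
  also have "\<dots> \<longleftrightarrow> sorted (map num (reduct w))"
    unfolding reduct_def remdups_adj_map_injective[OF inj_num, symmetric] sorted_remdups_adj_iff ..
  finally show ?thesis using sorted_word[OF word_reduct] by simp
qed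

lemma cost_sorted_words: "r \<in> sorted_words \<Longrightarrow> cost r = 3"
  by (auto simp: sorted_words_def cost_def)

fun inc :: "ltr \<Rightarrow> ltr" where "inc L0 = L1" | "inc L1 = L2" | "inc L2 = L0"

lemma num_inc: "num (inc m) = Suc (num m) mod 3"
  by (cases m) simp_all

type_synonym dst = "st \<times> ltr"

text \<open>The second component is the length of the reduct modulo 3. Since one flip changes the cost by at
  most one, the cost modulo 3 is enough to recognise an improving flip.\<close>
fun del :: "ltr \<Rightarrow> dst \<Rightarrow> dst" where
  "del c (q, m) = (tr c q, if fst q = c then m else inc m)"

text \<open>The counter starts at \<open>L1\<close>, that is 1, since the sentinel alone has length
  1.\<close>

abbreviation d0 :: dst where "d0 \<equiv> (q_2, L1)"

definition dfa :: "ltr list \<Rightarrow> dst" where "dfa w = foldr del w d0"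

fun cost3 :: "dst \<Rightarrow> nat" where "cost3 (q, m) = (num m + excess q) mod 3"

definition improves :: "dst \<Rightarrow> dst \<Rightarrow> bool" where
  "improves s s' \<longleftrightarrow> Suc (cost3 s') mod 3 = cost3 s"

lemma reduct_Cons: "reduct (c # w) = (if c = hd (reduct w) then reduct w else c # reduct w)"
  unfolding reduct_def by (cases w) simp_all

lemma fst_run_reduct: "fst (run w) = hd (reduct w)"
proof -
  have "reduct w \<noteq> []" by (simp add: reduct_def)
  then show ?thesis using fst_run[of "reduct w"] by simp
qed

lemma dfa_run: "fst (dfa w) = run w \<and> num (snd (dfa w)) = length (reduct w) mod 3"
proof (induction w)
  case Nil
  then show ?case by (simp add: dfa_def reduct_def)
next
  case (Cons c w)
  obtain q m where qm: "dfa w = (q, m)" by fastforce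
  have "dfa (c # w) = del c (dfa w)" by (simp add: dfa_def)
  then show ?case using Cons fst_run_reduct[of w]
    by (auto simp: qm reduct_Cons num_inc mod_Suc_eq)
qed

lemma cost3_dfa: "cost3 (dfa w) = cost (reduct w) mod 3"
  using dfa_run[of w] by (cases "dfa w") (simp add: cost_def mod_add_left_eq)

lemma flip_flip: "i \<le> length w \<Longrightarrow> flip i (flip i w) = w"
  by (simp add: flip_def)

lemma length_flip [simp]: "length (flip i w) = length w"
  by (simp add: flip_def)

text \<open>Flips are involutions, so \<open>cost_flip\<close> bounds the change of cost in both
  directions, and a change of -1, 0 or 1 can be read off modulo 3.\<close>

lemma improves_iff:
  assumes "1 \<le> i" "i \<le> length w"
  shows "improves (dfa w) (dfa (flip i w)) \<longleftrightarrow> Suc (cost (reduct (flip i w))) = cost (reduct w)"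
proof -
  have a: "cost (reduct w) \<le> Suc (cost (reduct (flip i w)))" using cost_flip[OF assms] .
  have b: "cost (reduct (flip i w)) \<le> Suc (cost (reduct w))"
    using cost_flip[of i "flip i w"] assms by (simp add: flip_flip)
  have "improves (dfa w) (dfa (flip i w)) \<longleftrightarrow>
      Suc (cost (reduct (flip i w))) mod 3 = cost (reduct w) mod 3"
    by (simp add: improves_def cost3_dfa mod_Suc_eq)
  moreover have "cost (reduct w) = Suc (cost (reduct (flip i w))) \<or>
    cost (reduct w) = cost (reduct (flip i w)) \<or> Suc (cost (reduct w)) = cost (reduct (flip i w))"
    using a b by linarith
  ultimately show ?thesis by (elim disjE) (auto, presburger+)
qed

section \<open>Optimal sorting sequences\<close>

definition letters :: "nat list \<Rightarrow> ltr list" where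
  "letters s = map (\<lambda>c. if c = 0 then L0 else if c = 1 then L1 else L2) s"

lemma map_num_letters: "ternary s \<Longrightarrow> map num (letters s) = s"
  unfolding ternary_def letters_def by (induction s) auto

lemma map_flip: "map f (flip i w) = flip i (map f w)"
  by (simp add: flip_def rev_map take_map drop_map)

lemma apply_flips_Nil [simp]: "apply_flips [] w = w"
  and apply_flips_Cons [simp]: "apply_flips (i # fs) w = apply_flips fs (flip i w)"
  by (simp_all add: apply_flips_def)

lemma map_apply_flips: "map f (apply_flips fs w) = apply_flips fs (map f w)"
  by (induction fs arbitrary: w) (simp_all add: map_flip)

lemma mset_apply_flips: "mset (apply_flips fs w) = mset w"
proof (induction fs arbitrary: w)
  case (Cons i fs)
  have "mset (flip i w) = mset (take i w @ drop i w)"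
    unfolding flip_def mset_append by simp
  then show ?case using Cons by simp
qed simp

lemma sorting_flips_iff:
  "sorting_flips (map num w) fs \<longleftrightarrow> valid_flips (length w) fs \<and> reduct (apply_flips fs w) \<in> sorted_words"
proof -
  have "apply_flips fs (map num w) = sort (map num w) \<longleftrightarrow> sorted (apply_flips fs (map num w))"
    using properties_for_sort[OF mset_apply_flips] by (metis sorted_sort)
  then show ?thesis by (simp add: sorting_flips_def sorted_reduct map_apply_flips)
qed

lemma cost_apply_flips: "valid_flips (length w) fs \<Longrightarrow> cost (reduct w) \<le> length fs + cost (reduct (apply_flips fs w))"
proof (induction fs arbitrary: w)
  case (Cons i fs)
  then have "cost (reduct w) \<le> Suc (cost (reduct (flip i w)))"
    by (intro cost_flip) (simp_all add: valid_flips_def)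
  also have "cost (reduct (flip i w)) \<le> length fs + cost (reduct (apply_flips fs (flip i w)))"
    using Cons by (simp add: valid_flips_def)
  finally show ?case by simp
qed simp

lemma shortest_sorting_flipsI:
  assumes "sorting_flips (map num w) fs" "length fs + 3 = cost (reduct w)"
  shows "shortest_sorting_flips (map num w) fs"
  unfolding shortest_sorting_flips_def
proof (intro conjI allI impI)
  fix gs assume "sorting_flips (map num w) gs"
  then show "length fs \<le> length gs"
    using cost_apply_flips[of w gs] cost_sorted_words assms(2) by (fastforce simp: sorting_flips_iff)
qed (fact assms(1))

section \<open>The sweeping machine\<close>

datatype mark = Plain | Last | Todo

text \<open>A work cell carries a letter of the current string (\<open>None\<close> for padding), a mark, the automaton
  state of the suffix to its right, and a symbol of the output (\<open>True\<close> for the unary digit, \<open>False\<close> for the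
  separator). The output symbols \<open>1\<close> and \<open>2\<close> of the final tape share their codes with the inputs \<open>In L0\<close> and \<open>In L1\<close>.\<close>

datatype cell = Blank | In ltr | Wk "ltr option" mark dst "bool option"

text \<open>\<open>Sel p f g b\<close> moves right with \<open>f\<close> and \<open>g\<close> the actions of the prefix and of the reversed prefix, and puts
  the mark \<open>Last\<close> on the end of the first improving prefix. \<open>Shift c p\<close> moves right, inserts the carried letter
  in front and takes out the first letter marked \<open>Todo\<close>; repeating this reverses the marked prefix. In
  both cases \<open>p\<close> tells that an output symbol is pending. \<open>Back q b c p\<close> moves left, refreshes the suffix
  states and finds the first letter \<open>c\<close> marked \<open>Todo\<close>. Each sweep to the right appends one padding cell.\<close>

datatype ctl = Init | Halt | Sel bool "dst \<Rightarrow> dst" "dst \<Rightarrow> dst" bool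
  | Shift "ltr option" bool | Back dst bool "ltr option" bool | Final

instance ltr :: finite
proof
  have "(UNIV :: ltr set) \<subseteq> {L0, L1, L2}" using ltr.exhaust by blast
  then show "finite (UNIV :: ltr set)" by (rule finite_subset) simp
qed

instance kind :: finite
proof
  have "(UNIV :: kind set) \<subseteq> {Good, Good012, NoBoth, No01, No12, End12, End212, Rare, Tiny}"
    using kind.exhaust by blast
  then show "finite (UNIV :: kind set)" by (rule finite_subset) simp
qed

instance idx :: finite
proof
  have "(UNIV :: idx set) \<subseteq> {I0, I1, I2, I3, I4, I5, I6, I7, I8, I9, I10, I11}"
    using idx.exhaust by blast
  then show "finite (UNIV :: idx set)" by (rule finite_subset) simp
qed

instance mark :: finite
proof
  have "(UNIV :: mark set) \<subseteq> {Plain, Last, Todo}" using mark.exhaust by blast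
  then show "finite (UNIV :: mark set)" by (rule finite_subset) simp
qed

instance cell :: finite
proof
  have "(UNIV :: cell set) \<subseteq> {Blank} \<union> range In \<union> range (\<lambda>(a, m, q, b). Wk a m q b)"
  proof
    fix x show "x \<in> {Blank} \<union> range In \<union> range (\<lambda>(a, m, q, b). Wk a m q b)"
      by (cases x) (auto simp: image_iff split: prod.splits)
  qed
  then show "finite (UNIV :: cell set)" by (rule finite_subset) simp
qed

text \<open>The functions carried by \<open>Sel\<close> range over a finite type because
  \<open>dst\<close> is finite; this makes the control a legitimate set of machine states.\<close>

instance ctl :: finite
proof
  have "(UNIV :: ctl set) \<subseteq> {Init, Halt, Final} \<union> range (\<lambda>(p, f, g, b). Sel p f g b) \<union>
    range (\<lambda>(c, p). Shift c p) \<union> range (\<lambda>(q, b, c, p). Back q b c p)"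
  proof
    fix x show "x \<in> {Init, Halt, Final} \<union> range (\<lambda>(p, f, g, b). Sel p f g b) \<union>
        range (\<lambda>(c, p). Shift c p) \<union> range (\<lambda>(q, b, c, p). Back q b c p)"
      by (cases x) (auto simp: image_iff split: prod.splits)
  qed
  then show "finite (UNIV :: ctl set)" by (rule finite_subset) simp
qed

fun emit :: "bool \<Rightarrow> bool \<Rightarrow> bool option \<Rightarrow> bool option" where
  "emit p b None = (if p then Some b else None)"
| "emit p b (Some b') = Some b'"

fun out_cell :: "bool option \<Rightarrow> cell" where
  "out_cell None = Blank"
| "out_cell (Some True) = In L0"
| "out_cell (Some False) = In L1"

fun delta :: "ctl \<Rightarrow> cell \<Rightarrow> ctl \<times> cell \<times> int" where
  "delta Init (In a) = (Init, Wk (Some a) Plain d0 None, 1)"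
| "delta Init Blank = (Back d0 False None False, Wk None Plain d0 None, 0)"
| "delta (Sel p f g b) (Wk None m q o') = (Sel (p \<and> o' \<noteq> None) f g b, Wk None m q (emit p False o'), 1)"
| "delta (Sel p f g b) (Wk (Some a) m q o') =
     (let t = (\<not> b \<and> improves (f (del a q)) (del a (g q))) in
     (Sel (p \<and> o' \<noteq> None) (f \<circ> del a) (del a \<circ> g) (b \<or> t),
      Wk (Some a) (if t then Last else Plain) q (emit p False o'), 1))"
| "delta (Sel p f g b) Blank =
     (if b then Back d0 False None True else Final, Wk None Plain d0 (emit p False None), 0)"
| "delta (Shift (Some c) p) (Wk (Some a) m q o') =
     (Shift (if m = Todo then None else Some a) (p \<and> o' \<noteq> None),
      Wk (Some c) (if m = Todo then Plain else m) q (emit p True o'), 1)"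
| "delta (Shift c p) (Wk a m q o') = (Shift c (p \<and> o' \<noteq> None), Wk a m q (emit p True o'), 1)"
| "delta (Shift c p) Blank = (Back d0 False None True, Wk None Plain d0 (emit p True None), 0)"
| "delta (Back s b c p) (Wk None m q o') = (Back s b c p, Wk None m s o', -1)"
| "delta (Back s b c p) (Wk (Some a) m q o') =
     (let b' = (b \<or> m = Last); t = (b' \<or> m = Todo) in
     (Back (del a s) b' (if t then Some a else c) p, Wk (Some a) (if t then Todo else Plain) s o', -1))"
| "delta (Back s b (Some c) p) Blank = (Shift (Some c) True, Blank, 1)"
| "delta (Back s b None p) Blank = (Sel p id id False, Blank, 1)"
| "delta Final (Wk a m q o') = (Final, out_cell o', -1)"
| "delta Final Blank = (Halt, Blank, 0)"
| "delta _ _ = (Halt, Blank, 0)"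

type_synonym conf = "ctl \<times> (int \<Rightarrow> cell) \<times> int"

fun step :: "conf \<Rightarrow> conf" where
  "step (s, T, h) = (if s = Halt then (s, T, h)
     else case delta s (T h) of (s', c, m) \<Rightarrow> (s', T(h := c), h + m))"

section \<open>Sweeps over the tape\<close>

definition tape :: "(nat \<Rightarrow> cell) \<Rightarrow> nat \<Rightarrow> int \<Rightarrow> cell" where
  "tape X N i = (if 0 \<le> i \<and> i < int N then X (nat i) else Blank)"

lemma tape_nth [simp]: "k < N \<Longrightarrow> tape X N (int k) = X k"
  and tape_end [simp]: "tape X N (int N) = Blank"
  and tape_neg [simp]: "tape X N (-1) = Blank"
  by (simp_all add: tape_def)

lemma tape_upd: "k < N \<Longrightarrow> (tape X N)(int k := c) = tape (X(k := c)) N"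
  by (auto simp: tape_def fun_eq_iff)

lemma tape_upd_end: "(tape X N)(int N := c) = tape (X(N := c)) (Suc N)"
  by (auto simp: tape_def fun_eq_iff)

lemma tape_cong: "(\<And>k. k < N \<Longrightarrow> X k = Y k) \<Longrightarrow> tape X N = tape Y N"
  by (auto simp: tape_def fun_eq_iff)

lemma steps_add: "(step ^^ m) c = c' \<Longrightarrow> (step ^^ n) c' = c'' \<Longrightarrow> (step ^^ (m + n)) c = c''"
  by (simp add: add.commute[of m n] funpow_add)

lemma sweep_right:
  assumes "\<And>k. k < N \<Longrightarrow> delta (S k) (X k) = (S (Suc k), Y k, 1)" "\<And>k. k < N \<Longrightarrow> S k \<noteq> Halt"
  shows "(step ^^ N) (S 0, tape X N, 0) = (S N, tape Y N, int N)"
proof -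
  have "n \<le> N \<Longrightarrow> (step ^^ n) (S 0, tape X N, 0) = (S n, tape (\<lambda>k. if k < n then Y k else X k) N, int n)" for n
  proof (induction n)
    case 0
    then show ?case by (simp add: tape_def)
  next
    case (Suc n)
    let ?X = "\<lambda>k. if k < n then Y k else X k"
    have e: "?X(n := Y n) = (\<lambda>k. if k < Suc n then Y k else X k)"
      by (auto simp: fun_eq_iff less_Suc_eq)
    have "(step ^^ Suc n) (S 0, tape X N, 0) = step (S n, tape ?X N, int n)" using Suc by simp
    also have "\<dots> = (S (Suc n), (tape ?X N)(int n := Y n), int (Suc n))"
      using assms[of n] Suc.prems by simp
    also have "\<dots> = (S (Suc n), tape (\<lambda>k. if k < Suc n then Y k else X k) N, int (Suc n))"
      using Suc.prems by (simp add: tape_upd e)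
    finally show ?case .
  qed
  moreover have "tape (\<lambda>k. if k < N then Y k else X k) N = tape Y N" by (rule tape_cong) simp
  ultimately show ?thesis by force
qed

lemma sweep_left:
  assumes "\<And>k. k < N \<Longrightarrow> delta (S (Suc k)) (X k) = (S k, Y k, -1)" "\<And>k. k < N \<Longrightarrow> S (Suc k) \<noteq> Halt"
  shows "(step ^^ N) (S N, tape X N, int N - 1) = (S 0, tape Y N, -1)"
proof -
  have "n \<le> N \<Longrightarrow> (step ^^ n) (S N, tape X N, int N - 1) =
    (S (N - n), tape (\<lambda>k. if N - n \<le> k then Y k else X k) N, int (N - n) - 1)" for n
  proof (induction n)
    case 0
    then show ?case by (auto simp: tape_def fun_eq_iff)
  next
    case (Suc n)
    define k where "k = N - Suc n"
    have k: "N - n = Suc k" "k < N" using Suc.prems by (auto simp: k_def)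
    let ?X = "\<lambda>j. if Suc k \<le> j then Y j else X j"
    have e: "?X(k := Y k) = (\<lambda>j. if k \<le> j then Y j else X j)"
      by (auto simp: fun_eq_iff Suc_le_eq)
    have "(step ^^ Suc n) (S N, tape X N, int N - 1) = step (S (Suc k), tape ?X N, int k)"
      using Suc k by simp
    also have "\<dots> = (S k, (tape ?X N)(int k := Y k), int k - 1)"
      using assms[of k] k(2) by simp
    also have "\<dots> = (S k, tape (\<lambda>j. if k \<le> j then Y j else X j) N, int k - 1)"
      by (simp add: tape_upd[OF k(2)] e)
    finally show ?case by (simp add: k_def)
  qed
  from this[of N] show ?thesis by simp
qed

text \<open>\<open>N\<close> steps to the right, one that appends a cell, \<open>N + 1\<close> to
  the left, and one on the blank at -1.\<close>

lemma sweep_round: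
  assumes R: "\<And>k. k < N \<Longrightarrow> delta (S k) (X k) = (S (Suc k), Y k, 1)" "\<And>k. k \<le> N \<Longrightarrow> S k \<noteq> Halt"
    and E: "delta (S N) Blank = (L (Suc N), Y N, 0)"
    and L: "\<And>k. k \<le> N \<Longrightarrow> delta (L (Suc k)) (Y k) = (L k, Z k, -1)" "\<And>k. k \<le> Suc N \<Longrightarrow> L k \<noteq> Halt"
    and B: "delta (L 0) Blank = (s, Blank, m)"
  shows "(step ^^ (2 * N + 3)) (S 0, tape X N, 0) = (s, tape Z (Suc N), m - 1)"
proof -
  have "(step ^^ N) (S 0, tape X N, 0) = (S N, tape Y N, int N)"
    using R by (intro sweep_right) auto
  moreover have "(step ^^ 1) (S N, tape Y N, int N) = (L (Suc N), tape Y (Suc N), int N)"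
    using E R(2)[of N] by (simp add: tape_upd_end)
  ultimately have "(step ^^ (N + 1)) (S 0, tape X N, 0) = (L (Suc N), tape Y (Suc N), int N)"
    by (rule steps_add)
  moreover have "(step ^^ Suc N) (L (Suc N), tape Y (Suc N), int (Suc N) - 1) = (L 0, tape Z (Suc N), -1)"
    using L by (intro sweep_left) auto
  ultimately have "(step ^^ (N + 1 + Suc N)) (S 0, tape X N, 0) = (L 0, tape Z (Suc N), -1)"
    by (intro steps_add) simp_all
  moreover have "(tape Z (Suc N))(-1 := Blank) = tape Z (Suc N)" by (auto simp: tape_def fun_eq_iff)
  then have "(step ^^ 1) (L 0, tape Z (Suc N), -1) = (s, tape Z (Suc N), m - 1)"
    using B L(2)[of 0] by simp
  ultimately have "(step ^^ (N + 1 + Suc N + 1)) (S 0, tape X N, 0) = (s, tape Z (Suc N), m - 1)"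
    by (rule steps_add)
  moreover have "N + 1 + Suc N + 1 = 2 * N + 3" by simp
  ultimately show ?thesis by metis
qed

section \<open>Tape contents and single rounds\<close>

definition nth_opt :: "'a list \<Rightarrow> nat \<Rightarrow> 'a option" where
  "nth_opt xs k = (if k < length xs then Some (xs ! k) else None)"

text \<open>\<open>p \<and> k \<le> length os\<close> is the pending flag on arrival at cell
  \<open>k\<close>: still up at the first free output cell, which has index
  \<open>length os\<close>, and down beyond it.\<close>

lemma emit_nth_opt:
  "emit (p \<and> k \<le> length os) x (nth_opt os k) = nth_opt (os @ (if p then [x] else [])) k"
  by (auto simp: nth_opt_def nth_append)

lemma emit_end:
  "length os \<le> N \<Longrightarrow> emit (p \<and> N \<le> length os) x None = nth_opt (os @ (if p then [x] else [])) N"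
  using emit_nth_opt[of p N os x] by (simp add: nth_opt_def[of os])

lemma pending_Suc: "(p \<and> k \<le> length os) \<and> nth_opt os k \<noteq> None \<longleftrightarrow> p \<and> Suc k \<le> length os"
  by (auto simp: nth_opt_def)

definition cells :: "ltr list \<Rightarrow> (nat \<Rightarrow> dst) \<Rightarrow> (nat \<Rightarrow> mark) \<Rightarrow> bool list \<Rightarrow> nat \<Rightarrow> cell" where
  "cells w A M os k = Wk (nth_opt w k) (if k < length w then M k else Plain) (A k) (nth_opt os k)"

definition ann :: "ltr list \<Rightarrow> nat \<Rightarrow> dst" where "ann w k = dfa (drop (Suc k) w)"

lemma dfa_drop: "k < length w \<Longrightarrow> dfa (drop k w) = del (w ! k) (dfa (drop (Suc k) w))"
  by (simp add: dfa_def Cons_nth_drop_Suc[symmetric])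

text \<open>\<open>b\<close> and \<open>c\<close> are the flag and the letter carried to the left,
  specified by recursion from the right; each round supplies closed forms for them.\<close>

lemma delta_Back:
  assumes "\<And>k. length w \<le> k \<Longrightarrow> \<not> b k \<and> c k = None"
    and "\<And>k. k < length w \<Longrightarrow> b k \<longleftrightarrow> b (Suc k) \<or> M k = Last"
    and "\<And>k. k < length w \<Longrightarrow> c k = (if b k \<or> M k = Todo then Some (w ! k) else c (Suc k))"
  shows "delta (Back (dfa (drop (Suc k) w)) (b (Suc k)) (c (Suc k)) p) (cells w A M os k) =
    (Back (dfa (drop k w)) (b k) (c k) p,
     cells w (ann w) (\<lambda>k. if b k \<or> M k = Todo then Todo else Plain) os k, -1)"
proof (cases "k < length w")
  case True
  then show ?thesis using assms(2,3)[of k] dfa_drop[of k w]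
    by (auto simp: cells_def nth_opt_def[of w] ann_def Let_def)
next
  case False
  then show ?thesis using assms(1)[of k] assms(1)[of "Suc k"]
    by (simp add: cells_def nth_opt_def[of w] ann_def)
qed

definition sel_conf :: "bool \<Rightarrow> ltr list \<Rightarrow> bool list \<Rightarrow> nat \<Rightarrow> conf" where
  "sel_conf p w os N = (Sel p id id False, tape (cells w (ann w) (\<lambda>_. Plain) os) N, 0)"

text \<open>Here \<open>w\<close> is the string after \<open>j\<close> letters of the prefix have
  been moved to the front; the remaining \<open>i - j\<close> are still marked.\<close>

definition shift_conf :: "nat \<Rightarrow> nat \<Rightarrow> ltr list \<Rightarrow> bool list \<Rightarrow> nat \<Rightarrow> conf" where
  "shift_conf j i w os N = (Shift (Some (w ! j)) True,
     tape (cells w (ann w) (\<lambda>k. if j \<le> k \<and> k < i then Todo else Plain) os) N, 0)"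

lemma init_round:
  "(step ^^ (2 * length w + 3)) (Init, tape (\<lambda>k. In (w ! k)) (length w), 0) = sel_conf False w [] (Suc (length w))"
proof -
  have "(step ^^ (2 * length w + 3)) ((\<lambda>_. Init) 0, tape (\<lambda>k. In (w ! k)) (length w), 0) =
    (Sel False id id False, tape (cells w (ann w) (\<lambda>k. if False \<or> Plain = Todo then Todo else Plain) []) (Suc (length w)), 1 - 1)"
  proof (rule sweep_round[where Y = "cells w (\<lambda>_. d0) (\<lambda>_. Plain) []"
        and L = "\<lambda>k. Back (dfa (drop k w)) False None False"])
    show "delta (Back (dfa (drop (Suc k) w)) False None False) (cells w (\<lambda>_. d0) (\<lambda>_. Plain) [] k) =
      (Back (dfa (drop k w)) False None False,
       cells w (ann w) (\<lambda>k. if False \<or> Plain = Todo then Todo else Plain) [] k, -1)" for k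
      by (rule delta_Back) simp_all
  qed (simp_all add: cells_def nth_opt_def dfa_def)
  then show ?thesis by (simp add: sel_conf_def)
qed

definition sel_state :: "bool \<Rightarrow> bool list \<Rightarrow> ltr list \<Rightarrow> (nat \<Rightarrow> bool) \<Rightarrow> nat \<Rightarrow> ctl" where
  "sel_state p os w b k =
     Sel (p \<and> k \<le> length os) (foldr del (take k w)) (foldr del (rev (take k w))) (b k)"

text \<open>At cell \<open>k\<close> the two functions, applied to the stored suffix state, yield
  the states of the whole string and of its flip, so the costs are compared without leaving the
  cell.\<close>

lemma delta_Sel:
  assumes "\<And>k. k < length w \<Longrightarrow>
      b (Suc k) \<longleftrightarrow> b k \<or> improves (dfa w) (dfa (flip (Suc k) w))"
    and "\<And>k. length w \<le> k \<Longrightarrow> b (Suc k) = b k"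
  shows "delta (sel_state p os w b k) (cells w (ann w) (\<lambda>_. Plain) os k) =
    (sel_state p os w b (Suc k),
     cells w (ann w) (\<lambda>k. if b (Suc k) \<and> \<not> b k then Last else Plain) (os @ (if p then [False] else [])) k, 1)"
proof (cases "k < length w")
  case True
  let ?q = "dfa (drop (Suc k) w)"
  have "foldr del (take k w) (del (w ! k) ?q) = dfa (take k w @ drop k w)"
    unfolding dfa_def foldr_append comp_def using dfa_drop[OF True] by (simp add: dfa_def)
  then have 1: "foldr del (take k w) (del (w ! k) ?q) = dfa w" by simp
  have 2: "del (w ! k) (foldr del (rev (take k w)) ?q) = dfa (flip (Suc k) w)"
    using True by (simp add: dfa_def flip_def take_Suc_conv_app_nth)
  show ?thesis
    using True assms(1)[OF True] 1 2 pending_Suc[of p k os] emit_nth_opt[of p k os False]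
    by (auto simp: sel_state_def cells_def nth_opt_def[of w] ann_def Let_def take_Suc_conv_app_nth fun_eq_iff)
next
  case False
  then show ?thesis using assms(2)[of k] pending_Suc[of p k os] emit_nth_opt[of p k os False]
    by (auto simp: sel_state_def cells_def nth_opt_def[of w] ann_def)
qed

lemma sel_round_found:
  assumes "1 \<le> i" "i \<le> length w" "improves (dfa w) (dfa (flip i w))"
    and "\<And>j. 1 \<le> j \<Longrightarrow> j < i \<Longrightarrow> \<not> improves (dfa w) (dfa (flip j w))"
    and "length w \<le> N" "length os \<le> N"
  shows "(step ^^ (2 * N + 3)) (sel_conf p w os N) =
    shift_conf 0 i w (os @ (if p then [False] else [])) (Suc N)"
proof -
  let ?os = "os @ (if p then [False] else [])"
  let ?S = "sel_state p os w (\<lambda>k. i \<le> k)"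
  let ?M = "\<lambda>k. if i \<le> Suc k \<and> \<not> i \<le> k then Last else Plain"
  let ?c = "\<lambda>k. if k < i then Some (w ! k) else None"
  let ?L = "\<lambda>k. Back (dfa (drop k w)) (k < i) (?c k) True"
  have "(step ^^ (2 * N + 3)) (?S 0, tape (cells w (ann w) (\<lambda>_. Plain) os) N, 0) =
    (Shift (Some (w ! 0)) True,
     tape (cells w (ann w) (\<lambda>k. if k < i \<or> ?M k = Todo then Todo else Plain) ?os) (Suc N), 1 - 1)"
  proof (rule sweep_round[where Y = "cells w (ann w) ?M ?os" and L = ?L])
    show "delta (?S k) (cells w (ann w) (\<lambda>_. Plain) os k) = (?S (Suc k), cells w (ann w) ?M ?os k, 1)" for k
    proof (rule delta_Sel)
      fix k assume "k < length w"
      show "i \<le> Suc k \<longleftrightarrow> i \<le> k \<or> improves (dfa w) (dfa (flip (Suc k) w))"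
      proof (cases i "Suc k" rule: linorder_cases)
        case greater
        then show ?thesis using assms(4)[of "Suc k"] by auto
      qed (use assms(3) in auto)
    next
      fix k assume "length w \<le> k"
      then show "(i \<le> Suc k) = (i \<le> k)" using assms(2) by simp
    qed
    show "delta (?L (Suc k)) (cells w (ann w) ?M ?os k) =
      (?L k, cells w (ann w) (\<lambda>k. if k < i \<or> ?M k = Todo then Todo else Plain) ?os k, -1)" for k
      by (rule delta_Back) (use assms(2) in auto)
    show "delta (?S N) Blank = (?L (Suc N), cells w (ann w) ?M ?os N, 0)"
      using assms(2,5) emit_end[OF assms(6), of p False]
      by (auto simp: sel_state_def cells_def nth_opt_def[of w] ann_def dfa_def)
  qed (use assms(1) in \<open>simp_all add: sel_state_def\<close>)
  moreover have "(\<lambda>k. if k < i \<or> ?M k = Todo then Todo else Plain) = (\<lambda>k. if 0 \<le> k \<and> k < i then Todo else Plain)"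
    by (auto simp: fun_eq_iff)
  ultimately show ?thesis using assms(1) by (simp add: sel_conf_def shift_conf_def sel_state_def id_def)
qed

lemma sel_round_final:
  assumes "\<And>j. 1 \<le> j \<Longrightarrow> j \<le> length w \<Longrightarrow> \<not> improves (dfa w) (dfa (flip j w))"
    and "length w \<le> N" "length os \<le> N"
  shows "(step ^^ (2 * N + 3)) (sel_conf p w os N) =
    (Halt, tape (\<lambda>k. out_cell (nth_opt (os @ (if p then [False] else [])) k)) (Suc N), -1)"
proof -
  let ?os = "os @ (if p then [False] else [])"
  let ?S = "sel_state p os w (\<lambda>_. False)"
  let ?M = "\<lambda>k :: nat. if False \<and> \<not> False then Last else Plain"
  have "(step ^^ (2 * N + 3)) (?S 0, tape (cells w (ann w) (\<lambda>_. Plain) os) N, 0) =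
    (Halt, tape (\<lambda>k. out_cell (nth_opt ?os k)) (Suc N), 0 - 1)"
  proof (rule sweep_round[where Y = "cells w (ann w) ?M ?os" and L = "\<lambda>_. Final"])
    show "delta (?S k) (cells w (ann w) (\<lambda>_. Plain) os k) = (?S (Suc k), cells w (ann w) ?M ?os k, 1)" for k
      by (rule delta_Sel) (use assms(1) in auto)
    show "delta (?S N) Blank = (Final, cells w (ann w) ?M ?os N, 0)"
      using assms(2) emit_end[OF assms(3), of p False]
      by (auto simp: sel_state_def cells_def nth_opt_def[of w] ann_def dfa_def)
  qed (simp_all add: sel_state_def cells_def)
  then show ?thesis by (simp add: sel_conf_def sel_state_def id_def)
qed

text \<open>A flip of length \<open>i\<close> consists of \<open>i\<close> such rounds, the first of
  which leaves the string unchanged. Each emits one digit, so the unary code of \<open>i\<close> is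
  written without a counter.\<close>

lemma shift_round:
  assumes "j < i" "i \<le> length w" "length w \<le> N" "length os \<le> N"
  defines "w' \<equiv> w ! j # take j w @ drop (Suc j) w"
  shows "(step ^^ (2 * N + 3)) (shift_conf j i w os N) =
    (if Suc j < i then shift_conf (Suc j) i w' (os @ [True]) (Suc N)
     else sel_conf True w' (os @ [True]) (Suc N))"
proof -
  let ?T = "\<lambda>j k. if j \<le> k \<and> k < i then Todo else Plain"
  \<comment> \<open>The letter in hand on arrival at cell \<open>k\<close>: first the one to be
    inserted in front, then the old letter of the left neighbour, and none past
    \<open>j\<close>.\<close>
  let ?carry = "\<lambda>k. if k \<le> j then Some (if k = 0 then w ! j else w ! (k - 1)) else None"
  let ?S = "\<lambda>k. Shift (?carry k) (True \<and> k \<le> length os)"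
  let ?c = "\<lambda>k. if Suc j < i \<and> k < i then Some (w' ! max k (Suc j)) else None"
  let ?L = "\<lambda>k. Back (dfa (drop k w')) False (?c k) True"
  let ?Z = "\<lambda>k. if False \<or> ?T (Suc j) k = Todo then Todo else Plain"
  have len: "length w' = length w" using assms(1,2) by (simp add: w'_def)
  have w': "w' ! k = (if k = 0 then w ! j else if k \<le> j then w ! (k - 1) else w ! k)" if "k < length w" for k
    using assms(1,2) that by (cases k) (auto simp: w'_def nth_append)
  have "(step ^^ (2 * N + 3)) (?S 0, tape (cells w (ann w) (?T j) os) N, 0) =
    (if Suc j < i then Shift (Some (w' ! Suc j)) True else Sel True id id False,
     tape (cells w' (ann w') ?Z (os @ [True])) (Suc N), 1 - 1)"
  proof (rule sweep_round[where S = ?S and Y = "cells w' (ann w) (?T (Suc j)) (os @ [True])" and L = ?L])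
    fix k
    have pe: "(True \<and> k \<le> length os \<and> nth_opt os k \<noteq> None) = (Suc k \<le> length os)"
      "emit (k \<le> length os) True (nth_opt os k) = nth_opt (os @ [True]) k"
      using pending_Suc[of True k os] emit_nth_opt[of True k os True] by auto
    show "delta (?S k) (cells w (ann w) (?T j) os k) = (?S (Suc k), cells w' (ann w) (?T (Suc j)) (os @ [True]) k, 1)"
    proof (cases "k \<le> j")
      case True
      then have "k < length w" using assms(1,2) by simp
      then show ?thesis using True assms(1) w'[of k] len pe
        by (auto simp: cells_def nth_opt_def[of w] nth_opt_def[of w'])
    next
      case False
      then show ?thesis using w'[of k] len pe
        by (auto simp: cells_def nth_opt_def[of w] nth_opt_def[of w'])
    qed
  next
    show "delta (?L (Suc k)) (cells w' (ann w) (?T (Suc j)) (os @ [True]) k) =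
        (?L k, cells w' (ann w') ?Z (os @ [True]) k, -1)" for k
    proof (rule delta_Back)
      fix k assume "k < length w'"
      show "?c k = (if False \<or> ?T (Suc j) k = Todo then Some (w' ! k) else ?c (Suc k))"
        by (auto simp: max_def not_less_eq_eq le_Suc_eq)
    qed (use assms(2) len in auto)
    show "delta (?S N) Blank = (?L (Suc N), cells w' (ann w) (?T (Suc j)) (os @ [True]) N, 0)"
      using assms(1-3) len emit_end[OF assms(4), of True True]
      by (auto simp: cells_def nth_opt_def[of w'] ann_def dfa_def)
  qed (auto simp: max_def)
  moreover have "?Z = ?T (Suc j)" by (auto simp: fun_eq_iff)
  moreover have "?T (Suc j) = (\<lambda>_. Plain)" if "\<not> Suc j < i" using that by (auto simp: fun_eq_iff)
  ultimately show ?thesis by (auto simp: sel_conf_def shift_conf_def)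
qed

text \<open>Each of the \<open>r\<close> rounds on a tape of at most \<open>N + r\<close> cells takes at most \<open>2 * (N + r) + 3\<close> steps.\<close>

definition goes :: "conf \<Rightarrow> nat \<Rightarrow> nat \<Rightarrow> conf \<Rightarrow> bool" where
  "goes c r N c' \<longleftrightarrow> (\<exists>t \<le> r * (2 * (N + r) + 3). (step ^^ t) c = c')"

lemma goes_round: "(step ^^ (2 * N + 3)) c = c' \<Longrightarrow> goes c 1 N c'"
  unfolding goes_def by (intro exI[of _ "2 * N + 3"]) simp

lemma goes_trans:
  assumes "goes c r N c'" "goes c' r' (N + r) c''"
  shows "goes c (r + r') N c''"
proof -
  obtain t t' where t: "t \<le> r * (2 * (N + r) + 3)" "(step ^^ t) c = c'"
      "t' \<le> r' * (2 * (N + r + r') + 3)" "(step ^^ t') c' = c''"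
    using assms by (auto simp: goes_def)
  have "r * (2 * (N + r) + 3) \<le> r * (2 * (N + r + r') + 3)" by (intro mult_le_mono2) simp
  with t(1,3) have "t + t' \<le> r * (2 * (N + r + r') + 3) + r' * (2 * (N + r + r') + 3)"
    by (meson add_mono le_trans)
  then have "t + t' \<le> (r + r') * (2 * (N + (r + r')) + 3)"
    by (simp add: add_mult_distrib add.assoc)
  with steps_add[OF t(2,4)] show ?thesis unfolding goes_def by blast
qed

lemma flip_Suc:
  assumes "j < length w"
  shows "flip (Suc j) w = flip j w ! j # take j (flip j w) @ drop (Suc j) (flip j w)"
  using assms by (simp add: flip_def nth_append take_Suc_conv_app_nth)

lemma shift_rounds:
  assumes "j < i" "i \<le> length w" "length w \<le> N" "length os \<le> N"
  shows "goes (shift_conf j i (flip j w) os N) (i - j) N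
    (sel_conf True (flip i w) (os @ replicate (i - j) True) (N + (i - j)))"
  using assms
proof (induction "i - j" arbitrary: j os N)
  case (Suc n)
  let ?os = "os @ [True]"
  note r = shift_round[of j i "flip j w" N os, folded flip_Suc[OF less_le_trans[OF Suc.prems(1,2)]]]
  show ?case
  proof (cases "Suc j < i")
    case True
    then have "goes (shift_conf j i (flip j w) os N) 1 N (shift_conf (Suc j) i (flip (Suc j) w) ?os (Suc N))"
      using r Suc.prems by (intro goes_round) simp
    moreover have "goes (shift_conf (Suc j) i (flip (Suc j) w) ?os (Suc N)) (i - Suc j) (Suc N)
      (sel_conf True (flip i w) (?os @ replicate (i - Suc j) True) (Suc N + (i - Suc j)))"
      using Suc True by (intro Suc.hyps(1)) auto
    ultimately have "goes (shift_conf j i (flip j w) os N) (1 + (i - Suc j)) N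
      (sel_conf True (flip i w) (?os @ replicate (i - Suc j) True) (Suc N + (i - Suc j)))"
      by (intro goes_trans) simp_all
    moreover have "1 + (i - Suc j) = i - j" "Suc N + (i - Suc j) = N + (i - j)"
      "?os @ replicate (i - Suc j) True = os @ replicate (i - j) True"
      using Suc.prems(1) by (simp_all add: Suc_diff_Suc[symmetric])
    ultimately show ?thesis by (simp only:)
  next
    case False
    then have "i = Suc j" using Suc.prems(1) by simp
    then have "goes (shift_conf j i (flip j w) os N) 1 N (sel_conf True (flip i w) ?os (Suc N))"
      using r Suc.prems by (intro goes_round) simp
    then show ?thesis using \<open>i = Suc j\<close> by simp
  qed
qed simp

section \<open>The complete computation\<close>

definition outs :: "nat list \<Rightarrow> bool list" where
  "outs fs = concat (map (\<lambda>i. replicate i True @ [False]) fs)"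

text \<open>A flip of length \<open>i\<close> takes one \<open>Sel\<close> round and
  \<open>i\<close> \<open>Shift\<close> rounds, hence at most \<open>length w + 1\<close>; the extra
  1 is the last round, which finds no improving flip and cleans the tape.\<close>

lemma sel_rounds:
  assumes "length w \<le> N" "length os \<le> N" "n + 3 = cost (reduct w)"
  shows "\<exists>fs r. length fs = n \<and> valid_flips (length w) fs \<and> reduct (apply_flips fs w) \<in> sorted_words \<and>
    r \<le> 1 + n * (length w + 1) \<and> length (os @ (if p then [False] else []) @ outs fs) \<le> N + r \<and>
    goes (sel_conf p w os N) r N
      (Halt, tape (\<lambda>k. out_cell (nth_opt (os @ (if p then [False] else []) @ outs fs) k)) (N + r), -1)"
  using assms
proof (induction n arbitrary: w p os N)
  case 0
  have no: "Suc (cost (reduct (flip j w))) \<noteq> cost (reduct w)" for j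
    using 0(3) cost_ge_3[OF word_reduct, of "flip j w"] by linarith
  then have "reduct w \<in> sorted_words" using cost_descent by blast
  moreover have "\<not> improves (dfa w) (dfa (flip j w))" if "1 \<le> j" "j \<le> length w" for j
    using improves_iff[OF that] no by blast
  then have "goes (sel_conf p w os N) 1 N
      (Halt, tape (\<lambda>k. out_cell (nth_opt (os @ (if p then [False] else [])) k)) (Suc N), -1)"
    using 0 by (intro goes_round sel_round_final) auto
  ultimately show ?case using 0(2)
    by (intro exI[of _ "[]"] exI[of _ 1]) (simp add: outs_def valid_flips_def)
next
  case (Suc n)
  let ?os = "os @ (if p then [False] else [])"
  let ?P = "\<lambda>i. 1 \<le> i \<and> i \<le> length w \<and> improves (dfa w) (dfa (flip i w))"
  have "reduct w \<notin> sorted_words" using cost_sorted_words[of "reduct w"] Suc.prems(3) by auto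
  then have "\<exists>i. ?P i" using cost_descent improves_iff by blast
  define i where "i = (LEAST i. ?P i)"
  have i: "?P i" unfolding i_def by (rule LeastI_ex) fact
  have least: "\<not> improves (dfa w) (dfa (flip j w))" if "1 \<le> j" "j < i" for j
    using not_less_Least[of j ?P] that i unfolding i_def[symmetric] by auto
  have "n + 3 = cost (reduct (flip i w))" using i improves_iff Suc.prems(3) by auto
  have "goes (sel_conf p w os N) 1 N (shift_conf 0 i w ?os (Suc N))"
    using i least Suc.prems(1,2) by (intro goes_round sel_round_found) auto
  moreover have "goes (shift_conf 0 i w ?os (Suc N)) i (N + 1)
      (sel_conf True (flip i w) (?os @ replicate i True) (Suc N + i))"
    using shift_rounds[of 0 i w "Suc N" ?os] i Suc.prems(1,2) by (simp add: flip_def)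
  ultimately have A: "goes (sel_conf p w os N) (1 + i) N
      (sel_conf True (flip i w) (?os @ replicate i True) (N + (1 + i)))"
    using goes_trans by fastforce
  have B: "length (flip i w) \<le> N + (1 + i)" "length (?os @ replicate i True) \<le> N + (1 + i)"
    using Suc.prems(1,2) by auto
  obtain fs r where fs: "length fs = n" "valid_flips (length w) fs" "reduct (apply_flips fs (flip i w)) \<in> sorted_words"
      "r \<le> 1 + n * (length w + 1)"
    and r: "length ((?os @ replicate i True) @ [False] @ outs fs) \<le> N + (1 + i) + r"
      "goes (sel_conf True (flip i w) (?os @ replicate i True) (N + (1 + i))) r (N + (1 + i))
        (Halt, tape (\<lambda>k. out_cell (nth_opt ((?os @ replicate i True) @ [False] @ outs fs) k)) (N + (1 + i) + r), -1)"
    using Suc.IH[OF B \<open>n + 3 = cost (reduct (flip i w))\<close>, of True] by (auto simp del: length_append)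
  have o: "(?os @ replicate i True) @ [False] @ outs fs = os @ (if p then [False] else []) @ outs (i # fs)"
    by (simp add: outs_def)
  have "goes (sel_conf p w os N) (1 + i + r) N
      (Halt, tape (\<lambda>k. out_cell (nth_opt (os @ (if p then [False] else []) @ outs (i # fs)) k)) (N + (1 + i + r)), -1)"
    using goes_trans[OF A r(2)] unfolding o by (simp add: add.assoc)
  moreover have "length (os @ (if p then [False] else []) @ outs (i # fs)) \<le> N + (1 + i + r)"
    using r(1) unfolding o by (simp only: add.assoc)
  moreover have "1 + i + r \<le> 1 + Suc n * (length w + 1)" using fs(4) i by simp
  moreover have "valid_flips (length w) (i # fs)" using fs(2) i by (auto simp: valid_flips_def)
  ultimately show ?case using fs(1,3) by (intro exI[of _ "i # fs"] exI[of _ "1 + i + r"]) simp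
qed

lemma goes_all:
  obtains fs r where "length fs + 3 = cost (reduct w)" "sorting_flips (map num w) fs"
    "r \<le> 2 * (length w + 1) ^ 2" "length (outs fs) \<le> length w + r"
    "goes (Init, tape (\<lambda>k. In (w ! k)) (length w), 0) r (length w)
      (Halt, tape (\<lambda>k. out_cell (nth_opt (outs fs) k)) (length w + r), -1)"
proof -
  define n where "n = cost (reduct w) - 3"
  have n: "n + 3 = cost (reduct w)" using cost_ge_3[OF word_reduct, of w] by (simp add: n_def)
  have "length (reduct w) \<le> Suc (length w)" unfolding reduct_def using remdups_adj_length[of "w @ [L2]"] by simp
  moreover have "excess (run w) \<le> 2" by (cases "kind_of (run w)") simp_all
  \<comment> \<open>The sentinel adds at most 1 to the length and the excess at most 2, which the
    subtracted 3 makes up for.\<close>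
  ultimately have "n \<le> length w" using n by (simp add: cost_def)
  obtain fs r where fs: "length fs = n" "valid_flips (length w) fs" "reduct (apply_flips fs w) \<in> sorted_words"
      "r \<le> 1 + n * (length w + 1)"
    and r: "length (outs fs) \<le> Suc (length w) + r"
      "goes (sel_conf False w [] (Suc (length w))) r (Suc (length w))
        (Halt, tape (\<lambda>k. out_cell (nth_opt (outs fs) k)) (Suc (length w) + r), -1)"
    using sel_rounds[of w "Suc (length w)" "[]" n False] n by auto
  have "goes (Init, tape (\<lambda>k. In (w ! k)) (length w), 0) (1 + r) (length w)
      (Halt, tape (\<lambda>k. out_cell (nth_opt (outs fs) k)) (length w + (1 + r)), -1)"
    using goes_trans[OF goes_round[OF init_round]] r(2) by simp
  moreover have "n * (length w + 1) \<le> length w * (length w + 1)" using \<open>n \<le> length w\<close> by (rule mult_le_mono1)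
  then have "1 + r \<le> 2 * (length w + 1) ^ 2" using fs(4) by (simp add: power2_eq_square)
  ultimately show ?thesis
    using that[of fs "1 + r"] fs r(1) n by (simp add: sorting_flips_iff)
qed

section \<open>Coding control and cells by numbers\<close>

text \<open>The list \<open>xs\<close> holds the elements whose codes are prescribed by the machine
  model, such as the blank and the start state.\<close>

lemma numbering:
  fixes xs :: "'a :: finite list"
  assumes "distinct xs"
  obtains f :: "'a \<Rightarrow> nat" and n where "inj f" "\<And>i. i < length xs \<Longrightarrow> f (xs ! i) = i"
    "\<And>x. f x < n" "length xs \<le> n"
proof -
  obtain ys where ys: "set ys = UNIV - set xs" "distinct ys"
    using finite_distinct_list[of "UNIV - set xs"] by auto
  define zs where "zs = xs @ ys"
  have zs: "distinct zs" "set zs = UNIV" using assms ys by (auto simp: zs_def)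
  define f where "f x = (THE i. i < length zs \<and> zs ! i = x)" for x
  have f: "f x < length zs \<and> zs ! f x = x" for x
  proof -
    have "x \<in> set zs" using zs(2) by simp
    then have "\<exists>!i. i < length zs \<and> zs ! i = x" using distinct_Ex1[OF zs(1)] by simp
    then show ?thesis unfolding f_def by (rule theI')
  qed
  show ?thesis
  proof (rule that[of f "length zs"])
    show "inj f" by (rule injI) (metis f)
    show "f (xs ! i) = i" if "i < length xs" for i
    proof -
      have "i < length zs" "zs ! i = xs ! i" using that by (simp_all add: zs_def nth_append)
      then show ?thesis using f[of "xs ! i"] nth_eq_iff_index_eq[OF zs(1)] by metis
    qed
  qed (use f in \<open>simp_all add: zs_def\<close>)
qed

lemma delta_move: "snd (snd (delta s c)) \<in> {-1, 0, 1}"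
  by (cases "(s, c)" rule: delta.cases) (simp_all add: Let_def)

theorem theorem4p7:
  shows "\<exists>M c k. valid_tm M \<and>
    (\<forall>s. ternary s \<longrightarrow>
       (\<exists>t fs. t \<le> c * (length s + 1) ^ k \<and> tm_outputs_within M s t fs \<and>
               shortest_sorting_flips s fs))"
proof -
  obtain ec :: "cell \<Rightarrow> nat" and nG where ec: "inj ec"
    "\<And>i. i < length [Blank, In L0, In L1, In L2] \<Longrightarrow> ec ([Blank, In L0, In L1, In L2] ! i) = i"
    "\<And>x. ec x < nG" "length [Blank, In L0, In L1, In L2] \<le> nG"
    by (rule numbering[of "[Blank, In L0, In L1, In L2]"], simp) (rule that)
  have ec_simps: "ec Blank = 0" "ec (In L0) = 1" "ec (In L1) = 2" "ec (In L2) = 3"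
    using ec(2)[of 0] ec(2)[of 1] ec(2)[of 2] ec(2)[of 3] by (simp_all add: numeral_eq_Suc)
  obtain es :: "ctl \<Rightarrow> nat" and nQ where es: "inj es"
    "\<And>i. i < length [Init, Halt] \<Longrightarrow> es ([Init, Halt] ! i) = i"
    "\<And>x. es x < nQ" "length [Init, Halt] \<le> nQ"
    by (rule numbering[of "[Init, Halt]"], simp) (rule that)
  have es_simps: "es Init = 0" "es Halt = 1" using es(2)[of 0] es(2)[of 1] by simp_all
  define \<delta> where "\<delta> q a = (case delta (inv es q) (inv ec a) of (s, c, m) \<Rightarrow> (es s, ec c, m))" for q a
  define M :: tm where "M = (nQ, nG, \<delta>)"
  have "case \<delta> q a of (q', a', d) \<Rightarrow> q' < nQ \<and> a' < nG \<and> d \<in> {-1, 0, 1}" for q a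
  proof -
    obtain s c m where e: "delta (inv es q) (inv ec a) = (s, c, m)" by (rule prod_cases3)
    then show ?thesis using delta_move[of "inv es q" "inv ec a"] ec(3) es(3) by (simp add: \<delta>_def)
  qed
  then have "valid_tm M" using ec(4) es(4) unfolding valid_tm_def M_def by simp
  define enc where "enc = (\<lambda>(s, T, h :: int). (es s, (\<lambda>i :: int. ec (T i)), h))"
  have "tm_step M (enc c) = enc (step c)" for c
  proof -
    obtain s T h where c: "c = (s, T, h)" by (cases c)
    have "es s = halt_state \<longleftrightarrow> s = Halt"
      using es_simps(2) es(1) by (metis halt_state_def injD)
    then show ?thesis
      by (auto simp: c tm_step_def M_def enc_def \<delta>_def inv_f_f[OF es(1)] inv_f_f[OF ec(1)] fun_eq_iff
          split: prod.splits)
  qed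
  then have run: "tm_run M t (enc c) = enc ((step ^^ t) c)" for t c
    unfolding tm_run_def by (induction t) simp_all
  \<comment> \<open>With \<open>m = length s + 1\<close> there are at most \<open>2 * m ^ 2\<close>
    rounds of at most \<open>9 * m ^ 2\<close> steps each.\<close>
  have "\<exists>t fs. t \<le> 18 * (length s + 1) ^ 4 \<and> tm_outputs_within M s t fs \<and> shortest_sorting_flips s fs"
    if "ternary s" for s
  proof -
    define w where "w = letters s"
    have s: "s = map num w" using map_num_letters[OF that] by (simp add: w_def)
    obtain fs r where fs: "length fs + 3 = cost (reduct w)" "sorting_flips (map num w) fs"
      and r: "r \<le> 2 * (length w + 1) ^ 2" "length (outs fs) \<le> length w + r"
      and g: "goes (Init, tape (\<lambda>k. In (w ! k)) (length w), 0) r (length w)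
      (Halt, tape (\<lambda>k. out_cell (nth_opt (outs fs) k)) (length w + r), -1)"
      by (rule goes_all)
    obtain t where t: "t \<le> r * (2 * (length w + r) + 3)"
      "(step ^^ t) (Init, tape (\<lambda>k. In (w ! k)) (length w), 0) =
        (Halt, tape (\<lambda>k. out_cell (nth_opt (outs fs) k)) (length w + r), -1)"
      using g by (auto simp: goes_def)
    have "init_config s = enc (Init, tape (\<lambda>k. In (w ! k)) (length w), 0)"
    proof -
      have "ec (In c) = num c + 1" for c using ec_simps by (cases c) simp_all
      then show ?thesis
        by (auto simp: init_config_def enc_def s es_simps ec_simps tape_def fun_eq_iff)
    qed
    then have fin: "tm_run M t (init_config s) =
        enc (Halt, tape (\<lambda>k. out_cell (nth_opt (outs fs) k)) (length w + r), -1)"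
      using run t(2) by simp
    have e: "enc_flips fs = map (\<lambda>b. if b then 1 else 2) (outs fs)"
      by (simp add: enc_flips_def outs_def map_concat comp_def)
    have "tape_holds (\<lambda>i. ec (tape (\<lambda>k. out_cell (nth_opt (outs fs) k)) (length w + r) i)) (enc_flips fs)"
      unfolding tape_holds_def e using r(2) ec_simps
      by (auto simp: tape_def nth_opt_def)
    then have "tm_outputs_within M s t fs"
      unfolding tm_outputs_within_def fin by (simp add: enc_def es_simps halt_state_def)
    moreover have "shortest_sorting_flips s fs"
      unfolding s by (rule shortest_sorting_flipsI[OF fs(2,1)])
    moreover have "t \<le> 18 * (length s + 1) ^ 4"
    proof -
      define m where "m = length w + 1"
      have m: "1 \<le> m" "m \<le> m ^ 2" by (simp_all add: m_def power2_eq_square)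
      then have "2 * (length w + r) + 3 \<le> 9 * m ^ 2" using r(1) unfolding m_def by simp
      with r(1) have "r * (2 * (length w + r) + 3) \<le> (2 * m ^ 2) * (9 * m ^ 2)"
        unfolding m_def by (rule mult_le_mono)
      also have "\<dots> = 18 * m ^ 4" by (simp add: power2_eq_square power4_eq_xxxx)
      finally show ?thesis using t(1) by (simp add: m_def s)
    qed
    ultimately show ?thesis by blast
  qed
  with \<open>valid_tm M\<close> show ?thesis by blast
qed

end
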